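(* Let $G_{\mathbb{C}}$ be a simple complex algebraic group with compact real form $G_{\mathbb{R}}$, let $\mathfrak{g}_{\mathbb{C}}$ be the Lie algebra of $G_{\mathbb{C}}$, and let $\iota$ be the involution given by complex conjugation, which leaves $G_{\mathbb{R}}$ pointwise fixed. Then for each root $\rho$ of $G_{\mathbb{R}}$, the involution $\iota$ exchanges the root space $\mathfrak{l}_{\rho}\subseteq\mathfrak{g}_{\mathbb{C}}$ with the root space $\mathfrak{l}_{-\rho}\subseteq\mathfrak{g}_{\mathbb{C}}$, and so acts as minus the identity on $[\mathfrak{l}_{\rho},\mathfrak{l}_{-\rho}]$.
   Context: Since the compact simple real Lie group $G_{\mathbb{R}}$ has a faithful real linear representation, $G_{\mathbb{C}}$ can be defined by extension of scalars, that is, by replacing real matrix entries with complex ones. Complex conjugation of matrix entries then induces a real (not complex analytic) involution $\iota:G_{\mathbb{C}}\rightarrow G_{\mathbb{C}}$ that leaves $G_{\mathbb{R}}$ pointwise fixed; the induced involution of $\mathfrak{g}_{\mathbb{C}}=\mathfrak{g}_{\mathbb{R}}\otimes_{\mathbb{R}}\mathbb{C}$, where $\mathfrak{g}_{\mathbb{R}}$ is the Lie algebra of $G_{\mathbb{R}}$, is also denoted $\iota$. Roots are taken with respect to the Cartan subalgebra $\mathfrak{h}=\mathfrak{t}\otimes_{\mathbb{R}}\mathbb{C}\subseteq\mathfrak{g}_{\mathbb{C}}$, where $\mathfrak{t}\subseteq\mathfrak{g}_{\mathbb{R}}$ is the Lie algebra of a maximal torus of $G_{\mathbb{R}}$. For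 a root $\rho$, the root space is $\mathfrak{l}_{\rho}=\{X\in\mathfrak{g}_{\mathbb{C}}:[H,X]=\rho(H)X\text{ for all }H\in\mathfrak{h}\}$, and $[\mathfrak{l}_{\rho},\mathfrak{l}_{-\rho}]\subseteq\mathfrak{h}$ is the bracket of the two root spaces.
   Formalization: As ι is conjugate linear, it cannot be minus the identity on the whole complex line [l_ρ, l_−ρ]; what is proved is that ι is minus the identity on the elements Z of [l_ρ, l_−ρ] with ρ(Z) real, and that these span [l_ρ, l_−ρ] over the complex numbers. *)

theory Defs
  imports "HOL-Analysis.Analysis" "HOL-Algebra.Coset"
begin

section \<open>Complex matrices and conjugation\<close>

text \<open>The type \<open>complex^'n^'n\<close> carries no complex scalar multiplication in the library, so
  it is introduced here, together with the resulting notion of complex span.\<close>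

definition mscale :: "complex \<Rightarrow> complex^'n^'n \<Rightarrow> complex^'n^'n" where
  "mscale c A = map_matrix ((*) c) A"

interpretation cmat: vector_space "mscale :: complex \<Rightarrow> complex^'n^'n \<Rightarrow> complex^'n^'n"
  by unfold_locales
    (simp_all add: mscale_def map_matrix_def vec_eq_iff algebra_simps)

definition complexify :: "real^'n^'n \<Rightarrow> complex^'n^'n" where
  "complexify = map_matrix complex_of_real"

text \<open>The involution \<open>\<iota>\<close>. Being real linear on matrices, it is its own differential, so the same
  map serves on the group and on its Lie algebra.\<close>

definition conj_mat :: "complex^'n^'n \<Rightarrow> complex^'n^'n" where
  "conj_mat = map_matrix cnj"

lemma conj_mat_complexify: "conj_mat (complexify A) = complexify A"
  by (simp add: conj_mat_def complexify_def map_matrix_def vec_eq_iff)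

lemma conj_mat_mscale: "conj_mat (mscale c A) = mscale (cnj c) (conj_mat A)"
  by (simp add: conj_mat_def mscale_def map_matrix_def vec_eq_iff)

text \<open>A conjugate-linear map cannot be minus the identity on a nonzero complex subspace.\<close>

lemma conj_mat_neg_on_subspace:
  assumes "cmat.subspace V" "\<And>Z. Z \<in> V \<Longrightarrow> conj_mat Z = - Z"
  shows "V \<subseteq> {0}"
proof
  fix Z assume Z: "Z \<in> V"
  have "mscale \<i> Z \<in> V"
    by (rule cmat.subspace_scale[OF assms(1) Z])
  then have "- mscale \<i> Z = mscale (- \<i>) (- Z)"
    using assms(2)[of "mscale \<i> Z"] assms(2)[OF Z] conj_mat_mscale[of "\<i>" Z] by simp
  then show "Z \<in> {0}"
    by (simp add: mscale_def map_matrix_def vec_eq_iff)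
qed

definition lie_bracket :: "complex^'n^'n \<Rightarrow> complex^'n^'n \<Rightarrow> complex^'n^'n" where
  "lie_bracket A B = A ** B - B ** A"

section \<open>Linear algebraic groups\<close>

definition GL :: "('a::field^'n^'n) monoid" where
  "GL = \<lparr>carrier = {A. invertible A}, mult = (**), one = mat 1\<rparr>"

text \<open>\<open>matrix_poly K\<close> is the set of functions given by polynomials in the matrix entries with
  coefficients in \<open>K\<close>.\<close>

inductive_set matrix_poly :: "complex set \<Rightarrow> (complex^'n^'n \<Rightarrow> complex) set" for K where
  const: "c \<in> K \<Longrightarrow> (\<lambda>A. c) \<in> matrix_poly K"
| entry: "(\<lambda>A. A $ i $ j) \<in> matrix_poly K"
| add: "p \<in> matrix_poly K \<Longrightarrow> q \<in> matrix_poly K \<Longrightarrow> (\<lambda>A. p A + q A) \<in> matrix_poly K"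
| mult: "p \<in> matrix_poly K \<Longrightarrow> q \<in> matrix_poly K \<Longrightarrow> (\<lambda>A. p A * q A) \<in> matrix_poly K"

text \<open>Regular functions on \<open>GL\<^sub>n\<close> also involve the inverse of the determinant, but clearing
  denominators shows that polynomials in the entries already give all closed subsets.\<close>

definition zariski_closed :: "(complex^'n^'n) set \<Rightarrow> bool" where
  "zariski_closed S \<longleftrightarrow>
     (\<exists>P \<subseteq> matrix_poly UNIV. S = {A \<in> carrier GL. \<forall>p\<in>P. p A = 0})"

definition zariski_connected :: "(complex^'n^'n) set \<Rightarrow> bool" where
  "zariski_connected S \<longleftrightarrow>
     \<not> (\<exists>U V. zariski_closed U \<and> zariski_closed V \<and> U \<noteq> {} \<and> V \<noteq> {} \<and>
              U \<inter> V = {} \<and> U \<union> V = S)"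

definition linear_algebraic_group :: "(complex^'n^'n) set \<Rightarrow> bool" where
  "linear_algebraic_group G \<longleftrightarrow> subgroup G GL \<and> zariski_closed G"

text \<open>Simplicity in the sense of algebraic groups: a finite centre is allowed.\<close>

definition simple_algebraic_group :: "(complex^'n^'n) set \<Rightarrow> bool" where
  "simple_algebraic_group G \<longleftrightarrow>
     linear_algebraic_group G \<and> zariski_connected G \<and>
     \<not> comm_group (GL\<lparr>carrier := G\<rparr>) \<and>
     (\<forall>N. linear_algebraic_group N \<and> zariski_connected N \<and> N \<lhd> GL\<lparr>carrier := G\<rparr>
        \<longrightarrow> N = {mat 1} \<or> N = G)"

text \<open>The real polynomial equations satisfied by \<open>GR\<close>, solved over the complex numbers.\<close>

definition extension_of_scalars :: "(real^'n^'n) set \<Rightarrow> (complex^'n^'n) set" where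
  "extension_of_scalars GR =
     {A \<in> carrier GL. \<forall>p \<in> matrix_poly \<real>. (\<forall>B\<in>GR. p (complexify B) = 0) \<longrightarrow> p A = 0}"

definition compact_real_form :: "(real^'n^'n) set \<Rightarrow> (complex^'n^'n) set \<Rightarrow> bool" where
  "compact_real_form GR GC \<longleftrightarrow>
     subgroup GR GL \<and> compact GR \<and>
     GC = extension_of_scalars GR \<and> GR = {B. complexify B \<in> GC}"

section \<open>Lie algebras and maximal tori\<close>

definition mexp :: "'a::real_normed_field^'n^'n \<Rightarrow> 'a^'n^'n" where
  "mexp A = (\<Sum>k. (((**) A) ^^ k) (mat 1) /\<^sub>R fact k)"

definition lie_algebra :: "('a::real_normed_field^'n^'n) set \<Rightarrow> ('a^'n^'n) set" where
  "lie_algebra G = {X. \<forall>t::real. mexp (t *\<^sub>R X) \<in> G}"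

definition torus_in :: "(real^'n^'n) set \<Rightarrow> (real^'n^'n) set \<Rightarrow> bool" where
  "torus_in T G \<longleftrightarrow>
     T \<subseteq> G \<and> subgroup T GL \<and> compact T \<and> connected T \<and> comm_group (GL\<lparr>carrier := T\<rparr>)"

definition maximal_torus :: "(real^'n^'n) set \<Rightarrow> (real^'n^'n) set \<Rightarrow> bool" where
  "maximal_torus T G \<longleftrightarrow>
     torus_in T G \<and> (\<forall>T'. torus_in T' G \<and> T \<subseteq> T' \<longrightarrow> T' = T)"

section \<open>Roots\<close>

text \<open>The Cartan subalgebra \<open>\<hh> = \<tt> \<otimes> \<complex>\<close>, with \<open>\<tt>\<close> the Lie algebra of the torus \<open>T\<close>.\<close>

definition cartan :: "(real^'n^'n) set \<Rightarrow> (complex^'n^'n) set" where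
  "cartan T = {complexify A + mscale \<i> (complexify B) | A B.
                 A \<in> lie_algebra T \<and> B \<in> lie_algebra T}"

definition root_space ::
  "(complex^'n^'n) set \<Rightarrow> (real^'n^'n) set \<Rightarrow> (complex^'n^'n \<Rightarrow> complex) \<Rightarrow> (complex^'n^'n) set"
  where
  "root_space GC T \<rho> =
     {X \<in> lie_algebra GC. \<forall>H \<in> cartan T. lie_bracket H X = mscale (\<rho> H) X}"

text \<open>A root is a functional on the Cartan subalgebra; only the values of \<open>\<rho>\<close> there matter.\<close>

definition is_root ::
  "(complex^'n^'n) set \<Rightarrow> (real^'n^'n) set \<Rightarrow> (complex^'n^'n \<Rightarrow> complex) \<Rightarrow> bool" where
  "is_root GC T \<rho> \<longleftrightarrow>
     (\<forall>H \<in> cartan T. \<forall>K \<in> cartan T. \<rho> (H + K) = \<rho> H + \<rho> K) \<and>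
     (\<forall>c. \<forall>H \<in> cartan T. \<rho> (mscale c H) = c * \<rho> H) \<and>
     (\<exists>H \<in> cartan T. \<rho> H \<noteq> 0) \<and>
     root_space GC T \<rho> \<noteq> {0}"

definition root_bracket ::
  "(complex^'n^'n) set \<Rightarrow> (real^'n^'n) set \<Rightarrow> (complex^'n^'n \<Rightarrow> complex) \<Rightarrow> (complex^'n^'n) set"
  where
  "root_bracket GC T \<rho> =
     cmat.span {lie_bracket X Y | X Y.
                  X \<in> root_space GC T \<rho> \<and> Y \<in> root_space GC T (\<lambda>H. - \<rho> H)}"

text \<open>The bracket of the two root spaces is a complex line, so by
  \<open>conj_mat_neg_on_subspace\<close> the involution can be minus the identity only on a real form of it.
  The relevant one is the real line spanned by the coroot of \<open>\<rho>\<close>, that is,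
  the part of the line on which \<open>\<rho>\<close> takes real values.\<close>

definition real_root_bracket ::
  "(complex^'n^'n) set \<Rightarrow> (real^'n^'n) set \<Rightarrow> (complex^'n^'n \<Rightarrow> complex) \<Rightarrow> (complex^'n^'n) set"
  where
  "real_root_bracket GC T \<rho> = {Z \<in> root_bracket GC T \<rho>. \<rho> Z \<in> \<real>}"

end

theory Submission
  imports Defs "HOL-Complex_Analysis.Cauchy_Integral_Formula"
begin

text \<open>A torus is compact, so \<open>exp (t A)\<close> is bounded for \<open>A \<in> \<tt>\<close>; hence \<open>\<rho>\<close> is purely imaginary on \<open>\<tt>\<close>,
  and conjugating \<open>[H, X] = \<rho>(H) X\<close> exchanges the two root spaces. The complex space
  \<open>W\<close> spanned by \<open>[\<ll>\<^sub>\<rho>, \<ll>\<^sub>-\<^sub>\<rho>]\<close> is therefore stable under conjugation. It centralizes the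
  Cartan subalgebra, and the maximality of the torus puts its real points in \<open>\<tt>\<close>.

  It remains to see that \<open>\<rho>\<close> is injective on the real points of \<open>W\<close>, which needs
  neither the Killing form nor the dimension of the root spaces. If \<open>\<rho> A = 0\<close>, then \<open>A\<close> commutes with
  \<open>\<ll>\<^sub>\<rho>\<close>; being a combination of brackets \<open>[X, Y]\<close> with \<open>X \<in> \<ll>\<^sub>\<rho>\<close>, it satisfies
  \<open>tr (A R) = 0\<close> for every \<open>R\<close> that commutes with \<open>\<ll>\<^sub>\<rho>\<close>. So all powers of \<open>A\<close> have trace zero, and since \<open>A\<close>
  is semisimple by boundedness of \<open>exp (t A)\<close>, \<open>A = 0\<close>.\<close>

section \<open>The matrix exponential\<close>

lemma map_matrix_nth [simp]: "map_matrix f A $ i $ j = f (A $ i $ j)"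
  by (simp add: map_matrix_def)

lemma norm_vec_scale:
  fixes v :: "'a::real_normed_field^'n"
  shows "norm (\<chi> j. c * v $ j) = norm c * norm v"
  by (simp add: norm_vec_def norm_mult L2_set_right_distrib)

text \<open>The norm is the Frobenius norm. Each row of \<open>A ** B\<close> is a combination of
  the rows of \<open>B\<close>, bounded by the triangle inequality and Cauchy-Schwarz.\<close>

lemma norm_matrix_mult_le:
  fixes A :: "'a::real_normed_field^'n^'m" and B :: "'a^'p^'n"
  shows "norm (A ** B) \<le> norm A * norm B"
proof -
  have row: "norm ((A ** B) $ i) \<le> norm (A $ i) * norm B" for i
  proof -
    have "(A ** B) $ i = (\<Sum>k\<in>UNIV. \<chi> j. A $ i $ k * B $ k $ j)"
      by (simp add: vec_eq_iff matrix_matrix_mult_def)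
    then have "norm ((A ** B) $ i) \<le> (\<Sum>k\<in>UNIV. norm (A $ i $ k) * norm (B $ k))"
      by (simp add: norm_vec_scale sum_norm_le)
    also have "\<dots> = (\<Sum>k\<in>UNIV. \<bar>norm (A $ i $ k)\<bar> * \<bar>norm (B $ k)\<bar>)"
      by simp
    also have "\<dots> \<le> L2_set (\<lambda>k. norm (A $ i $ k)) UNIV * L2_set (\<lambda>k. norm (B $ k)) UNIV"
      by (rule L2_set_mult_ineq)
    finally show ?thesis
      by (simp add: norm_vec_def)
  qed
  have "norm (A ** B) \<le> L2_set (\<lambda>i. norm (A $ i) * norm B) UNIV"
    unfolding norm_vec_def[of "A ** B"] by (rule L2_set_mono) (use row in auto)
  also have "\<dots> = norm A * norm B"
    by (simp add: norm_vec_def[of A] L2_set_left_distrib)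
  finally show ?thesis .
qed

lemma matrix_mult_scaleR_left:
  fixes A :: "'a::real_normed_field^'n^'m" and B :: "'a^'p^'n"
  shows "(r *\<^sub>R A) ** B = r *\<^sub>R (A ** B)"
  by (simp add: vec_eq_iff matrix_matrix_mult_def scaleR_sum_right algebra_simps)

lemma matrix_mult_scaleR_right:
  fixes A :: "'a::real_normed_field^'n^'m" and B :: "'a^'p^'n"
  shows "A ** (r *\<^sub>R B) = r *\<^sub>R (A ** B)"
  by (simp add: vec_eq_iff matrix_matrix_mult_def scaleR_sum_right)

lemma bounded_bilinear_matrix_mult:
  "bounded_bilinear ((**) :: 'a::real_normed_field^'n^'m \<Rightarrow> 'a^'p^'n \<Rightarrow> 'a^'p^'m)"
proof
  show "\<exists>K. \<forall>(a::'a^'n^'m) (b::'a^'p^'n). norm (a ** b) \<le> norm a * norm b * K"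
    by (rule exI[of _ 1]) (simp add: norm_matrix_mult_le)
qed (simp_all add: matrix_matrix_mult_def vec_eq_iff sum.distrib algebra_simps scaleR_sum_right)

interpretation matrix_mult: bounded_bilinear
  "(**) :: 'a::real_normed_field^'n^'m \<Rightarrow> 'a^'p^'n \<Rightarrow> 'a^'p^'m"
  by (rule bounded_bilinear_matrix_mult)

definition mpow :: "'a::semiring_1^'n^'n \<Rightarrow> nat \<Rightarrow> 'a^'n^'n" where
  "mpow A k = ((**) A ^^ k) (mat 1)"

lemma mpow_0 [simp]: "mpow A 0 = mat 1"
  by (simp add: mpow_def)

lemma mpow_Suc [simp]: "mpow A (Suc k) = A ** mpow A k"
  by (simp add: mpow_def)

lemma norm_mpow_le:
  fixes A :: "'a::real_normed_field^'n^'n"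
  shows "norm (mpow A k) \<le> norm (mat 1 :: 'a^'n^'n) * norm A ^ k"
proof (induction k)
  case (Suc k)
  have "norm (mpow A (Suc k)) \<le> norm A * norm (mpow A k)"
    by (simp add: norm_matrix_mult_le)
  also have "\<dots> \<le> norm A * (norm (mat 1 :: 'a^'n^'n) * norm A ^ k)"
    by (intro mult_left_mono Suc) auto
  finally show ?case by (simp add: mult_ac)
qed simp

lemma mpow_scale:
  fixes A :: "'a::comm_semiring_1^'n^'n"
  shows "mpow (map_matrix ((*) c) A) k = map_matrix ((*) (c ^ k)) (mpow A k)"
  by (induction k) (simp_all add: vec_eq_iff matrix_matrix_mult_def sum_distrib_left mult_ac)

text \<open>The factor \<open>norm (mat 1)\<close> is there because the identity need not have
  Frobenius norm 1. Taking \<open>r = norm A\<close> gives convergence, a fixed \<open>r\<close>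
  gives uniformity on a ball.\<close>

lemma exp_series_le:
  fixes A :: "'a::real_normed_field^'n^'n"
  assumes "norm A \<le> r"
  shows "norm (mpow A k /\<^sub>R fact k) \<le> norm (mat 1 :: 'a^'n^'n) * (r ^ k /\<^sub>R fact k)"
proof -
  have "norm (mpow A k) \<le> norm (mat 1 :: 'a^'n^'n) * r ^ k"
    by (rule order_trans[OF norm_mpow_le]) (intro mult_left_mono power_mono assms; simp)
  then show ?thesis
    by (simp add: divide_simps)
qed

section \<open>Convergence and differentiation of the exponential series\<close>

lemma mexp_sums:
  fixes A :: "'a::{real_normed_field,banach}^'n^'n"
  shows "(\<lambda>k. mpow A k /\<^sub>R fact k) sums mexp A"
proof -
  have "summable (\<lambda>k. norm (mat 1 :: 'a^'n^'n) * (norm A ^ k /\<^sub>R fact k))"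
    by (intro summable_mult summable_exp_generic)
  then have "summable (\<lambda>k. norm (mpow A k /\<^sub>R fact k))"
    by (rule summable_comparison_test'[where N = 0]) (simp only: real_norm_def abs_norm_cancel, rule exp_series_le, rule order_refl)
  then show ?thesis
    unfolding mexp_def mpow_def[symmetric] by (rule summable_sums[OF summable_norm_cancel])
qed

lemma bounded_linear_entry:
  "bounded_linear (\<lambda>A :: 'a::real_normed_vector^'n^'m. A $ i $ j)"
  by (rule bounded_linear_compose[OF bounded_linear_vec_nth bounded_linear_vec_nth])

lemma mexp_entry_sums:
  fixes A :: "'a::{real_normed_field,banach}^'n^'n"
  shows "(\<lambda>k. mpow A k $ i $ j / fact k) sums (mexp A $ i $ j)"
proof -
  have "(\<lambda>k. (mpow A k /\<^sub>R fact k) $ i $ j) sums (mexp A $ i $ j)"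
    by (rule bounded_linear.sums[OF bounded_linear_entry mexp_sums])
  then show ?thesis
    by (simp add: scaleR_conv_of_real[where 'a='a] divide_inverse mult.commute)
qed

text \<open>For fixed \<open>A\<close> each entry of exp (c A) is a scalar power series in c, so
  termwise differentiation applies, over the reals and the complex numbers alike.\<close>

lemma mexp_scale_entry_sums:
  fixes A :: "'a::{real_normed_field,banach}^'n^'n"
  shows "(\<lambda>k. (mpow A k $ i $ j / fact k) * c ^ k) sums (mexp (map_matrix ((*) c) A) $ i $ j)"
  using mexp_entry_sums[of "map_matrix ((*) c) A" i j] by (simp add: mpow_scale mult_ac)

lemma matrix_mult_mexp_scale_sums:
  fixes A :: "'a::{real_normed_field,banach}^'n^'n"
  shows "(\<lambda>k. (mpow A (Suc k) $ i $ j / fact k) * c ^ k) sums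
           ((A ** mexp (map_matrix ((*) c) A)) $ i $ j)"
proof -
  have "(\<lambda>k. \<Sum>l\<in>UNIV. A $ i $ l * ((mpow A k $ l $ j / fact k) * c ^ k)) sums
          (\<Sum>l\<in>UNIV. A $ i $ l * (mexp (map_matrix ((*) c) A) $ l $ j))"
    by (intro sums_sum sums_mult mexp_scale_entry_sums)
  moreover have "(\<Sum>l\<in>UNIV. A $ i $ l * ((mpow A k $ l $ j / fact k) * c ^ k))
      = (mpow A (Suc k) $ i $ j / fact k) * c ^ k" for k
    by (simp add: matrix_matrix_mult_def sum_distrib_right sum_divide_distrib mult.assoc)
  ultimately show ?thesis
    by (simp add: matrix_matrix_mult_def)
qed

lemma mexp_scale_entry_DERIV:
  fixes A :: "'a::{real_normed_field,banach}^'n^'n"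
  shows "((\<lambda>c. mexp (map_matrix ((*) c) A) $ i $ j) has_field_derivative
           (A ** mexp (map_matrix ((*) c) A)) $ i $ j) (at c)"
proof -
  let ?a = "\<lambda>k. mpow A k $ i $ j / fact k"
  have eq: "(\<lambda>c. \<Sum>k. ?a k * c ^ k) = (\<lambda>c. mexp (map_matrix ((*) c) A) $ i $ j)"
    using mexp_scale_entry_sums[of A i j] by (simp only: sums_iff)
  have "((\<lambda>c. \<Sum>k. ?a k * c ^ k) has_field_derivative (\<Sum>k. diffs ?a k * c ^ k)) (at c)"
    using mexp_scale_entry_sums[of A i j]
    by (intro termdiffs_strong_converges_everywhere) (auto dest: sums_summable)
  moreover have "diffs ?a k = mpow A (Suc k) $ i $ j / fact k" for k
    by (simp add: diffs_def del: mpow_Suc of_nat_Suc)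
  ultimately show ?thesis
    using matrix_mult_mexp_scale_sums[of A i j c] unfolding eq sums_iff by simp
qed

lemma scaleR_eq_map_matrix:
  fixes A :: "'a::real_normed_field^'n^'m"
  shows "t *\<^sub>R A = map_matrix ((*) (of_real t)) A"
  by (simp add: vec_eq_iff scaleR_conv_of_real[where 'a='a])

lemma has_vector_derivative_matrixI:
  fixes f :: "real \<Rightarrow> 'a::real_normed_vector^'n^'m"
  assumes "\<And>i j. ((\<lambda>t. f t $ i $ j) has_vector_derivative f' $ i $ j) (at t)"
  shows "(f has_vector_derivative f') (at t)"
proof -
  have "((\<lambda>y. (\<chi> i j. (f y $ i $ j - f t $ i $ j - (y - t) *\<^sub>R f' $ i $ j) /\<^sub>R norm (y - t)))
          \<longlongrightarrow> (\<chi> i j. 0)) (at t)"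
    using assms unfolding has_vector_derivative_def has_derivative_at_within
    by (intro tendsto_vec_lambda) auto
  then show ?thesis
    unfolding has_vector_derivative_def has_derivative_at_within
    by (auto intro!: bounded_linear_scaleR_left elim!: back_subst[of "\<lambda>f. (f \<longlongrightarrow> _) _"]
        simp: vec_eq_iff zero_vec_def fun_eq_iff)
qed

lemma mexp_has_vector_derivative:
  fixes A :: "'a::{real_normed_field,banach}^'n^'n"
  shows "((\<lambda>t. mexp (t *\<^sub>R A)) has_vector_derivative A ** mexp (t *\<^sub>R A)) (at t)"
proof (rule has_vector_derivative_matrixI)
  fix i j
  show "((\<lambda>t. mexp (t *\<^sub>R A) $ i $ j) has_vector_derivative (A ** mexp (t *\<^sub>R A)) $ i $ j) (at t)"
    using field_vector_diff_chain_at[OF has_vector_derivative_of_real[OF DERIV_ident]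
        mexp_scale_entry_DERIV[of A i j "of_real t"]]
    by (simp add: o_def scaleR_eq_map_matrix)
qed

section \<open>Exponentials of commuting matrices and one-parameter groups\<close>

lemma mexp_0 [simp]: "mexp (0 :: 'a::{real_normed_field,banach}^'n^'n) = mat 1"
proof -
  have "mpow (0 :: 'a^'n^'n) k /\<^sub>R fact k = (if k = 0 then mat 1 else 0)" for k
    by (cases k) auto
  then show ?thesis
    using mexp_sums[of "0 :: 'a^'n^'n"] sums_single[of 0 "\<lambda>_. mat 1 :: 'a^'n^'n"]
    by (auto dest: sums_unique2)
qed

lemma mexp_commute:
  fixes A :: "'a::{real_normed_field,banach}^'n^'n"
  assumes "A ** B = B ** A"
  shows "mexp A ** B = B ** mexp A"
proof -
  have "mpow A k ** B = B ** mpow A k" for k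
    by (induction k) (simp_all add: matrix_mul_assoc[symmetric] assms, simp add: matrix_mul_assoc assms)
  then have "(\<lambda>k. (mpow A k /\<^sub>R fact k) ** B) = (\<lambda>k. B ** (mpow A k /\<^sub>R fact k))"
    by (simp add: matrix_mult_scaleR_left matrix_mult_scaleR_right)
  moreover have "(\<lambda>k. (mpow A k /\<^sub>R fact k) ** B) sums (mexp A ** B)"
    by (rule bounded_linear.sums[OF matrix_mult.bounded_linear_left mexp_sums])
  moreover have "(\<lambda>k. B ** (mpow A k /\<^sub>R fact k)) sums (B ** mexp A)"
    by (rule bounded_linear.sums[OF matrix_mult.bounded_linear_right mexp_sums])
  ultimately show ?thesis
    by (simp add: sums_unique2)
qed

lemma mexp_scaleR_commute:
  fixes A :: "'a::{real_normed_field,banach}^'n^'n"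
  shows "A ** B = B ** A \<Longrightarrow> mexp (t *\<^sub>R A) ** B = B ** mexp (t *\<^sub>R A)"
  by (intro mexp_commute) (simp add: matrix_mult_scaleR_left matrix_mult_scaleR_right)


text \<open>For any solution g of g' = A g the product exp (-t A) g(t) has derivative zero, since
  exp (-t A) commutes with \<open>A\<close>; so it is constantly g(0).\<close>

lemma mexp_ODE_unique:
  fixes A :: "'a::{real_normed_field,banach}^'n^'n"
  assumes f: "\<And>t. (f has_vector_derivative A ** f t) (at t)"
  shows "f t = mexp (t *\<^sub>R A) ** f 0"
proof -
  have const: "mexp (t *\<^sub>R (- A)) ** g t = g 0"
    if g: "\<And>t. (g has_vector_derivative A ** g t) (at t)" for g t
  proof -
    have "((\<lambda>t. mexp (t *\<^sub>R (- A)) ** g t) has_vector_derivative 0) (at t)" for t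
    proof -
      have "mexp (t *\<^sub>R (- A)) ** (A ** g t) + ((- A) ** mexp (t *\<^sub>R (- A))) ** g t = 0"
        using mexp_scaleR_commute[of "- A" A t]
        by (simp add: matrix_mul_assoc matrix_mult.minus_left matrix_mult.minus_right)
      then show ?thesis
        using matrix_mult.has_vector_derivative[OF mexp_has_vector_derivative[of "- A" t] g[of t]]
        by simp
    qed
    then obtain c where "\<And>t. mexp (t *\<^sub>R (- A)) ** g t = c"
      using has_vector_derivative_zero_constant[of UNIV "\<lambda>t. mexp (t *\<^sub>R (- A)) ** g t"] by auto
    from this[of t] this[of 0] show ?thesis by simp
  qed
  \<comment> \<open>The solution exp (t A) itself shows that exp (-t A) is its inverse.\<close>
  have "mexp (t *\<^sub>R (- A)) ** mexp (t *\<^sub>R A) = mat 1"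
    using const[OF mexp_has_vector_derivative] by simp
  then have "mexp (t *\<^sub>R A) ** mexp (t *\<^sub>R (- A)) = mat 1"
    by (simp add: matrix_left_right_inverse)
  then show ?thesis
    using const[OF f, of t] by (metis matrix_mul_assoc matrix_mul_lid)
qed

text \<open>Since exp (t A) commutes with \<open>B\<close>, the product exp (t A) exp (t B) solves
  the equation with matrix \<open>A + B\<close>; uniqueness is used at t = 1.\<close>

lemma mexp_add:
  fixes A :: "'a::{real_normed_field,banach}^'n^'n"
  assumes AB: "A ** B = B ** A"
  shows "mexp (A + B) = mexp A ** mexp B"
proof -
  have "((\<lambda>t. mexp (t *\<^sub>R A) ** mexp (t *\<^sub>R B)) has_vector_derivative
          (A + B) ** (mexp (t *\<^sub>R A) ** mexp (t *\<^sub>R B))) (at t)" for t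
    using matrix_mult.has_vector_derivative[OF mexp_has_vector_derivative[of A t]
        mexp_has_vector_derivative[of B t]] mexp_scaleR_commute[OF AB, of t]
    by (simp add: matrix_mul_assoc matrix_mult.add_left add.commute)
  from mexp_ODE_unique[of "\<lambda>t. mexp (t *\<^sub>R A) ** mexp (t *\<^sub>R B)", OF this, of 1]
  show ?thesis by simp
qed

lemma mexp_minus_mult [simp]:
  fixes A :: "'a::{real_normed_field,banach}^'n^'n"
  shows "mexp (- A) ** mexp A = mat 1" "mexp A ** mexp (- A) = mat 1"
  using mexp_add[of "- A" A] mexp_add[of A "- A"]
  by (simp_all add: matrix_mult.minus_left matrix_mult.minus_right)

lemma invertible_mexp [simp]:
  "invertible (mexp (A :: 'a::{real_normed_field,banach}^'n^'n))"
  unfolding invertible_def by (meson mexp_minus_mult)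

lemma mexp_scaleR_add:
  fixes A :: "'a::{real_normed_field,banach}^'n^'n"
  shows "mexp ((s + t) *\<^sub>R A) = mexp (s *\<^sub>R A) ** mexp (t *\<^sub>R A)"
  unfolding scaleR_add_left
  by (rule mexp_add) (simp add: matrix_mult_scaleR_left matrix_mult_scaleR_right mult.commute)

lemma commute_if_mexp_commute:
  fixes A B :: "'a::{real_normed_field,banach}^'n^'n"
  assumes "\<And>t::real. mexp (t *\<^sub>R A) ** B = B ** mexp (t *\<^sub>R A)"
  shows "A ** B = B ** A"
proof -
  have 1: "((\<lambda>t. mexp (t *\<^sub>R A) ** B) has_vector_derivative A ** B) (at 0)"
    using matrix_mult.has_vector_derivative[OF mexp_has_vector_derivative[of A 0]
        has_vector_derivative_const[of B]] by simp
  have 2: "((\<lambda>t. B ** mexp (t *\<^sub>R A)) has_vector_derivative B ** A) (at 0)"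
    using matrix_mult.has_vector_derivative[OF has_vector_derivative_const[of B]
        mexp_has_vector_derivative[of A 0]] by simp
  show ?thesis
    by (rule vector_derivative_unique_at[OF 1]) (use 2 assms in simp)
qed

section \<open>Entrywise homomorphisms, continuity and the derivative at zero\<close>

lemma map_matrix_mult:
  assumes "\<And>x y. h (x + y) = h x + h y" "h 0 = 0" "\<And>x y. h (x * y) = h x * h y"
  shows "map_matrix h (A ** B) = map_matrix h A ** map_matrix h B"
  using sum_comp_morphism[OF assms(2,1), of _ UNIV]
  by (simp add: vec_eq_iff matrix_matrix_mult_def o_def assms flip: sum_comp_morphism[OF assms(2,1)])

text \<open>Meant for \<open>cnj\<close> and \<open>of_real\<close>, which are continuous and real
  linear and so act on the exponential series term by term.\<close>

lemma map_matrix_mexp: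
  fixes h :: "'a::{real_normed_field,banach} \<Rightarrow> 'b::{real_normed_field,banach}"
  assumes h: "bounded_linear h" "h 1 = 1" "\<And>x y. h (x * y) = h x * h y"
  shows "map_matrix h (mexp A) = mexp (map_matrix h A)"
proof -
  interpret bounded_linear h by fact
  have "mpow (map_matrix h A) k = map_matrix h (mpow A k)" for k
  proof (induction k)
    case 0
    show ?case by (simp add: vec_eq_iff mat_def h zero)
  qed (simp add: map_matrix_mult[OF add zero h(3)])
  moreover have "(\<lambda>k. h (mpow A k $ i $ j / fact k)) sums (h (mexp A $ i $ j))" for i j
    by (rule sums[OF mexp_entry_sums])
  moreover have "h (x / fact k) = h x / fact k" for x k
    using scaleR[of "inverse (fact k)" x]
    by (simp add: scaleR_conv_of_real divide_inverse mult.commute)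
  ultimately have "(\<lambda>k. mpow (map_matrix h A) k $ i $ j / fact k) sums (h (mexp A $ i $ j))" for i j
    by simp
  from sums_unique2[OF this mexp_entry_sums] show ?thesis
    by (simp add: vec_eq_iff)
qed

lemma continuous_on_mexp:
  "continuous_on UNIV (mexp :: 'a::{real_normed_field,banach}^'n^'n \<Rightarrow> _)"
proof -
  have "continuous_on (ball 0 r) (mexp :: 'a^'n^'n \<Rightarrow> _)" for r
  proof (rule uniform_limit_theorem)
    show "uniform_limit (ball 0 r) (\<lambda>n (A::'a^'n^'n). \<Sum>k<n. mpow A k /\<^sub>R fact k) mexp sequentially"
      unfolding mexp_def mpow_def[symmetric]
    proof (rule Weierstrass_m_test)
      show "norm (mpow A k /\<^sub>R fact k) \<le> norm (mat 1 :: 'a^'n^'n) * (r ^ k /\<^sub>R fact k)"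
        if "A \<in> ball 0 r" for k and A :: "'a^'n^'n"
        using that by (intro exp_series_le) auto
      show "summable (\<lambda>k. norm (mat 1 :: 'a^'n^'n) * (r ^ k /\<^sub>R fact k))"
        by (intro summable_mult summable_exp_generic)
    qed
    have "continuous_on S (\<lambda>A :: 'a^'n^'n. mpow A k)" for k S
      by (induction k) (auto intro!: continuous_intros matrix_mult.continuous_on)
    then show "\<forall>\<^sub>F n in sequentially. continuous_on (ball 0 r) (\<lambda>A :: 'a^'n^'n. \<Sum>k<n. mpow A k /\<^sub>R fact k)"
      by (intro always_eventually allI continuous_intros)
  qed simp
  then have "isCont mexp A" for A :: "'a^'n^'n"
    by (rule continuous_on_interior[where S = "ball 0 (norm A + 1)"]) auto
  then show ?thesis
    by (simp add: continuous_on_eq_continuous_at)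
qed

text \<open>The tail of the series from the quadratic term on is bounded by a constant times
  \<open>norm A ^ 2\<close> near 0.\<close>

lemma mexp_has_derivative_0:
  "(mexp has_derivative (\<lambda>A. A)) (at (0 :: 'a::{real_normed_field,banach}^'n^'n))"
proof -
  let ?N = "norm (mat 1 :: 'a^'n^'n)"
  have bound: "norm (mexp A - mat 1 - A) \<le> ?N * exp 1 * norm A ^ 2" if "norm A \<le> 1" for A :: "'a^'n^'n"
  proof -
    have "(\<lambda>k. mpow A (k + 2) /\<^sub>R fact (k + 2)) sums (mexp A - (\<Sum>k<2. mpow A k /\<^sub>R fact k))"
      by (rule sums_split_initial_segment[OF mexp_sums])
    then have s: "(\<lambda>k. mpow A (k + 2) /\<^sub>R fact (k + 2)) sums (mexp A - mat 1 - A)"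
      by (simp add: numeral_2_eq_2 diff_diff_eq)
    have e: "(\<lambda>k. ?N * norm A ^ 2 * (1 ^ k /\<^sub>R fact k)) sums (?N * norm A ^ 2 * exp 1)"
      by (intro sums_mult exp_converges)
    \<comment> \<open>As \<open>norm A \<le> 1\<close>, the exponent k + 2 may be lowered to 2, and
      1 / (k + 2)! is at most 1 / k!; the majorant then sums to a multiple of
      \<open>exp 1\<close>.\<close>
    have le: "norm (mpow A (k + 2) /\<^sub>R fact (k + 2)) \<le> ?N * norm A ^ 2 * (1 ^ k /\<^sub>R fact k)" for k
    proof -
      have "norm (mpow A (k + 2)) \<le> ?N * norm A ^ (k + 2)"
        by (rule norm_mpow_le)
      also have "\<dots> \<le> ?N * norm A ^ 2"
        using that by (intro mult_left_mono power_decreasing) auto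
      finally have "norm (mpow A (k + 2)) / fact (k + 2) \<le> ?N * norm A ^ 2 / fact k"
        by (intro frac_le fact_mono) (auto simp del: mpow_Suc)
      then show ?thesis
        by (simp add: divide_inverse mult_ac del: fact_Suc)
    qed
    have "norm (mexp A - mat 1 - A) \<le> (\<Sum>k. ?N * norm A ^ 2 * (1 ^ k /\<^sub>R fact k))"
      unfolding sums_unique[OF s] by (rule norm_suminf_le[OF le sums_summable[OF e]])
    then show ?thesis
      using sums_unique[OF e] by (simp add: mult_ac)
  qed
  have "((\<lambda>A. ?N * exp 1 * norm A) \<longlongrightarrow> 0) (at (0 :: 'a^'n^'n))"
    by (auto intro!: tendsto_eq_intros)
  moreover have "\<forall>\<^sub>F A in at (0 :: 'a^'n^'n). norm ((mexp A - mat 1 - A) /\<^sub>R norm A) \<le> ?N * exp 1 * norm A"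
  proof -
    have "norm ((mexp A - mat 1 - A) /\<^sub>R norm A) \<le> ?N * exp 1 * norm A"
      if "norm A < 1" "A \<noteq> 0" for A :: "'a^'n^'n"
      using bound[of A] that by (simp add: divide_simps power2_eq_square mult_ac)
    then show ?thesis
      unfolding eventually_at by (intro exI[of _ 1]) (auto simp: dist_norm)
  qed
  ultimately have "((\<lambda>A. (mexp A - mat 1 - A) /\<^sub>R norm A) \<longlongrightarrow> 0) (at (0 :: 'a^'n^'n))"
    by (rule Lim_null_comparison[rotated])
  then show ?thesis
    by (simp add: has_derivative_at_within)
qed

section \<open>Closed subgroups and tori\<close>

text \<open>For square matrices a one-sided inverse is two-sided, so a right inverse in
  \<open>S\<close> can stand in for the group inverse.\<close>

lemma subgroup_GL_iff:
  "subgroup S (GL :: ('a::field^'n^'n) monoid) \<longleftrightarrow>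
     mat 1 \<in> S \<and> (\<forall>A\<in>S. \<forall>B\<in>S. A ** B \<in> S) \<and> (\<forall>A\<in>S. \<exists>B\<in>S. A ** B = mat 1)"
  (is "?L \<longleftrightarrow> ?R")
proof -
  have [simp]: "invertible (mat 1 :: 'a^'n^'n)"
    by (auto simp: invertible_def)
  interpret group "GL :: ('a^'n^'n) monoid"
  proof (rule groupI)
    fix A :: "'a^'n^'n"
    assume "A \<in> carrier GL"
    then show "\<exists>B\<in>carrier GL. B \<otimes>\<^bsub>GL\<^esub> A = \<one>\<^bsub>GL\<^esub>"
      by (auto simp: GL_def invertible_def)
  qed (auto simp: GL_def invertible_mult matrix_mul_assoc)
  show ?thesis
  proof
    assume ?L
    then interpret S: subgroup S GL .
    have "\<exists>B\<in>S. A ** B = mat 1" if "A \<in> S" for A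
      using S.m_inv_closed[OF that] r_inv[OF S.mem_carrier[OF that]] by (auto simp: GL_def)
    then show ?R
      using S.one_closed S.m_closed by (auto simp: GL_def)
  next
    assume R: ?R
    have inv: "A \<in> carrier GL" if "A \<in> S" for A
      using R that unfolding GL_def partial_object.select_convs mem_Collect_eq invertible_right_inverse by blast
    show ?L
    proof (rule subgroupI)
      show "inv\<^bsub>GL\<^esub> A \<in> S" if A: "A \<in> S" for A
      proof -
        obtain B where B: "B \<in> S" "A ** B = mat 1"
          using R A by blast
        then have "B \<otimes>\<^bsub>GL\<^esub> A = \<one>\<^bsub>GL\<^esub>"
          by (simp add: GL_def matrix_left_right_inverse)
        then have "inv\<^bsub>GL\<^esub> A = B"
          by (rule inv_equality) (use inv A B in auto)
        then show ?thesis using B by simp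
      qed
    qed (use R inv in \<open>auto simp: GL_def\<close>)
  qed
qed

lemma comm_group_GL_iff:
  assumes "subgroup S (GL :: ('a::field^'n^'n) monoid)"
  shows "comm_group (GL\<lparr>carrier := S\<rparr>) \<longleftrightarrow> (\<forall>A\<in>S. \<forall>B\<in>S. A ** B = B ** A)"
proof
  assume "comm_group (GL\<lparr>carrier := S\<rparr>)"
  then interpret comm_group "GL\<lparr>carrier := S\<rparr>" .
  show "\<forall>A\<in>S. \<forall>B\<in>S. A ** B = B ** A"
    using m_comm by (auto simp: GL_def)
next
  assume c: "\<forall>A\<in>S. \<forall>B\<in>S. A ** B = B ** A"
  note sub = assms[unfolded subgroup_GL_iff]
  have "group (GL\<lparr>carrier := S\<rparr>)"
  proof (rule groupI)
    fix A assume "A \<in> carrier (GL\<lparr>carrier := S\<rparr>)"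
    then show "\<exists>B\<in>carrier (GL\<lparr>carrier := S\<rparr>). B \<otimes>\<^bsub>GL\<lparr>carrier := S\<rparr>\<^esub> A = \<one>\<^bsub>GL\<lparr>carrier := S\<rparr>\<^esub>"
      using sub by (simp add: GL_def) (metis matrix_left_right_inverse)
  qed (use sub in \<open>auto simp: GL_def matrix_mul_assoc\<close>)
  then show "comm_group (GL\<lparr>carrier := S\<rparr>)"
    by (rule group.group_comm_groupI) (use c in \<open>auto simp: GL_def\<close>)
qed

lemma subgroup_GL_inverse:
  assumes "subgroup S (GL :: ('a::field^'n^'n) monoid)" "A \<in> S" "A ** B = mat 1"
  shows "B \<in> S"
proof -
  obtain C where "C \<in> S" "A ** C = mat 1"
    using assms unfolding subgroup_GL_iff by blast
  moreover have "B ** A = mat 1"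
    using assms(3) by (simp add: matrix_left_right_inverse)
  ultimately show ?thesis
    by (metis matrix_mul_assoc matrix_mul_lid matrix_mul_rid)
qed

section \<open>Lie algebras of closed matrix groups\<close>

lemma lie_algebra_scaleR: "X \<in> lie_algebra S \<Longrightarrow> r *\<^sub>R X \<in> lie_algebra S"
  by (simp add: lie_algebra_def)

lemma lie_algebra_uminus: "X \<in> lie_algebra S \<Longrightarrow> - X \<in> lie_algebra S"
  using lie_algebra_scaleR[of X S "-1"] by simp

lemma mexp_lie_algebra: "X \<in> lie_algebra S \<Longrightarrow> mexp X \<in> S"
  unfolding lie_algebra_def by (metis (mono_tags, lifting) mem_Collect_eq scaleR_one)

text \<open>Commutation is differentiated twice, first along the one-parameter group of
  \<open>Y\<close> and then along that of \<open>X\<close>.\<close>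

lemma lie_algebra_commute:
  fixes X Y :: "'a::{real_normed_field,banach}^'n^'n"
  assumes "\<And>A B. A \<in> S \<Longrightarrow> B \<in> S \<Longrightarrow> A ** B = B ** A"
    and "X \<in> lie_algebra S" "Y \<in> lie_algebra S"
  shows "X ** Y = Y ** X"
proof (rule commute_if_mexp_commute)
  fix t :: real
  have "Y ** mexp (t *\<^sub>R X) = mexp (t *\<^sub>R X) ** Y"
    by (rule commute_if_mexp_commute) (use assms in \<open>auto simp: lie_algebra_def\<close>)
  then show "mexp (t *\<^sub>R X) ** Y = Y ** mexp (t *\<^sub>R X)" ..
qed

lemma subspace_lie_algebra_commutative:
  fixes S :: "('a::{real_normed_field,banach}^'n^'n) set"
  assumes S: "subgroup S GL" and comm: "\<And>A B. A \<in> S \<Longrightarrow> B \<in> S \<Longrightarrow> A ** B = B ** A"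
  shows "subspace (lie_algebra S)"
proof (rule subspaceI)
  show "0 \<in> lie_algebra S"
    using S by (simp add: lie_algebra_def subgroup_GL_iff)
  fix X Y assume XY: "X \<in> lie_algebra S" "Y \<in> lie_algebra S"
  have "mexp (t *\<^sub>R (X + Y)) = mexp (t *\<^sub>R X) ** mexp (t *\<^sub>R Y)" for t
    unfolding scaleR_add_right
    by (rule mexp_add) (simp add: matrix_mult_scaleR_left matrix_mult_scaleR_right
        lie_algebra_commute[OF comm XY])
  then show "X + Y \<in> lie_algebra S"
    using XY S by (auto simp: lie_algebra_def subgroup_GL_iff)
qed (rule lie_algebra_scaleR)

text \<open>Expansion in an orthonormal basis of \<open>L\<close>. It serves to split a matrix into
  a Lie algebra part and an orthogonal part, and later to compare an idempotent with the orthogonal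
  projection onto its range.\<close>

lemma orthogonal_projection_exists:
  fixes L :: "'a::euclidean_space set"
  assumes "subspace L"
  obtains P where "linear P" "\<And>x. P x \<in> L" "\<And>x y. y \<in> L \<Longrightarrow> (x - P x) \<bullet> y = 0"
proof -
  obtain B where B: "B \<subseteq> L" "pairwise orthogonal B" "\<And>b. b \<in> B \<Longrightarrow> norm b = 1"
      "independent B" "span B = L"
    using orthonormal_basis_subspace[OF assms] by metis
  then have fin: "finite B"
    by (simp add: independent_imp_finite)
  define P where "P x = (\<Sum>b\<in>B. (x \<bullet> b) *\<^sub>R b)" for x
  have "linear P"
    by (rule linearI) (simp_all add: P_def inner_add_left scaleR_add_left sum.distrib scaleR_sum_right)
  moreover have "P x \<in> L" for x
    unfolding P_def using B(1) by (intro subspace_sum[OF assms] subspace_scale[OF assms]) auto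
  moreover have "(x - P x) \<bullet> y = 0" if "y \<in> L" for x y
  proof -
    have "orthogonal (x - P x) b" if "b \<in> B" for b
    proof -
      have "P x \<bullet> b = (\<Sum>c\<in>B. if c = b then x \<bullet> b else 0)"
        unfolding P_def inner_sum_left
      proof (rule sum.cong[OF refl])
        fix c assume "c \<in> B"
        then show "(x \<bullet> c) *\<^sub>R c \<bullet> b = (if c = b then x \<bullet> b else 0)"
          using B(2) B(3)[OF that] that by (auto simp: pairwise_def orthogonal_def norm_eq_1)
      qed
      then show ?thesis
        using fin that by (simp add: orthogonal_def inner_diff_left)
    qed
    then show ?thesis
      using orthogonal_to_span[of y B "x - P x"] that B(5) by (auto simp: orthogonal_def)
  qed
  ultimately show ?thesis ..
qed

lemma mexp_of_nat_mem:
  fixes S :: "('a::{real_normed_field,banach}^'n^'n) set"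
  assumes S: "subgroup S GL" and "mexp Y \<in> S"
  shows "mexp (real k *\<^sub>R Y) \<in> S"
proof (induction k)
  case 0
  then show ?case using S by (simp add: subgroup_GL_iff)
next
  case (Suc k)
  have "mexp (real (Suc k) *\<^sub>R Y) = mexp (1 *\<^sub>R Y) ** mexp (real k *\<^sub>R Y)"
    by (subst mexp_scaleR_add[symmetric]) simp
  then show ?case using S Suc assms(2) by (simp add: subgroup_GL_iff)
qed

lemma isCont_mexp: "isCont mexp (A :: 'a::{real_normed_field,banach}^'n^'n)"
  using continuous_on_mexp[where 'a = 'a and 'n = 'n] by (simp add: continuous_on_eq_continuous_at)

text \<open>Integer multiples of the ever smaller \<open>y n\<close> converge to any prescribed
  point of the ray through \<open>u\<close>; their exponentials are powers of elements of
  \<open>S\<close>, and \<open>S\<close> is closed. The opposite ray follows by inversion.\<close>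

lemma limit_direction_in_lie_algebra:
  fixes S :: "('a::{real_normed_field,banach}^'n^'n) set"
  assumes S: "subgroup S GL" "closed S"
    and y: "\<And>n. mexp (y n) \<in> S" "\<And>n. y n \<noteq> 0" "y \<longlonglongrightarrow> 0"
    and u: "(\<lambda>n. y n /\<^sub>R norm (y n)) \<longlonglongrightarrow> u"
  shows "u \<in> lie_algebra S"
proof -
  have pos: "mexp (s *\<^sub>R u) \<in> S" if "s \<ge> 0" for s
  proof -
    \<comment> \<open>The number of steps of length \<open>norm (y n)\<close> that fit into s;
      rounding down costs at most one step, which tends to zero.\<close>
    define k where "k n = nat \<lfloor>s / norm (y n)\<rfloor>" for n
    have "\<bar>real (k n) * norm (y n) - s\<bar> \<le> norm (y n)" for n
    proof -
      have "real (k n) \<le> s / norm (y n)" "s / norm (y n) < real (k n) + 1"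
        unfolding k_def using that by (auto simp: of_nat_nat)
      then show ?thesis
        using y(2)[of n] by (simp add: field_simps abs_le_iff)
    qed
    moreover have "(\<lambda>n. norm (y n)) \<longlonglongrightarrow> 0"
      using tendsto_norm[OF y(3)] by simp
    ultimately have "(\<lambda>n. real (k n) * norm (y n) - s) \<longlonglongrightarrow> 0"
      by (intro Lim_null_comparison[of "\<lambda>n. real (k n) * norm (y n) - s" "\<lambda>n. norm (y n)"]
          always_eventually) auto
    then have "(\<lambda>n. real (k n) * norm (y n)) \<longlonglongrightarrow> s"
      by (rule LIM_zero_cancel)
    then have "(\<lambda>n. (real (k n) * norm (y n)) *\<^sub>R (y n /\<^sub>R norm (y n))) \<longlonglongrightarrow> s *\<^sub>R u"
      by (rule tendsto_scaleR[OF _ u])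
    then have "(\<lambda>n. real (k n) *\<^sub>R y n) \<longlonglongrightarrow> s *\<^sub>R u"
      using y(2) by (simp add: mult.assoc)
    then have "(\<lambda>n. mexp (real (k n) *\<^sub>R y n)) \<longlonglongrightarrow> mexp (s *\<^sub>R u)"
      by (rule isCont_tendsto_compose[OF isCont_mexp])
    then show ?thesis
      by (rule closed_sequentially[OF S(2) mexp_of_nat_mem[OF S(1) y(1)]])
  qed
  have "mexp (s *\<^sub>R u) \<in> S" for s
  proof (cases "s \<ge> 0")
    case False
    have "mexp (- (s *\<^sub>R u)) \<in> S"
      using pos[of "- s"] False by simp
    then show ?thesis
      by (rule subgroup_GL_inverse[OF S(1)]) simp
  qed (rule pos)
  then show ?thesis
    by (simp add: lie_algebra_def)
qed

text \<open>Von Neumann's argument: an element of \<open>S\<close> near the identity is \<open>exp x exp y\<close> with \<open>x\<close> in the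
  Lie algebra and \<open>y\<close> orthogonal to it, and the directions of nonzero such \<open>y\<close> would accumulate
  at an element of the Lie algebra.\<close>

lemma mexp_locally_onto:
  fixes S :: "(real^'n^'n) set"
  assumes S: "subgroup S GL" "closed S" and sub: "subspace (lie_algebra S)"
  shows "\<exists>e>0. \<forall>g\<in>S. dist g (mat 1) < e \<longrightarrow> g \<in> mexp ` lie_algebra S"
proof (rule ccontr)
  assume neg: "\<not> ?thesis"
  let ?L = "lie_algebra S"
  obtain P where P: "linear P" "\<And>x. P x \<in> ?L" "\<And>x y. y \<in> ?L \<Longrightarrow> (x - P x) \<bullet> y = 0"
    using orthogonal_projection_exists[OF sub] by blast
  \<comment> \<open>The Lie algebra component and the orthogonal component are exponentiated
    separately; the derivative at 0 is the identity.\<close>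
  define \<phi> where "\<phi> M = mexp (P M) ** mexp (M - P M)" for M
  have P0: "P 0 = 0"
    using P(1) by (rule linear_0)
  have contP: "continuous_on UNIV P"
    using P(1) by (simp add: linear_continuous_on linear_linear)
  have cont: "continuous_on UNIV \<phi>"
    unfolding \<phi>_def
    by (intro matrix_mult.continuous_on continuous_on_compose2[OF continuous_on_mexp]
        continuous_intros contP) auto
  have dP: "(P has_derivative P) (at 0)"
    using P(1) by (simp add: linear_imp_has_derivative)
  have d1: "((\<lambda>M. mexp (P M)) has_derivative P) (at 0)"
    using has_derivative_compose[OF dP, of mexp "\<lambda>A. A"] mexp_has_derivative_0 by (simp add: P0)
  have "((\<lambda>M. M - P M) has_derivative (\<lambda>M. M - P M)) (at 0)"
    by (intro derivative_intros dP)
  then have d2: "((\<lambda>M. mexp (M - P M)) has_derivative (\<lambda>M. M - P M)) (at 0)"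
    using has_derivative_compose[of "\<lambda>M. M - P M" "\<lambda>M. M - P M" 0 UNIV mexp "\<lambda>A. A"]
      mexp_has_derivative_0 by (simp add: P0)
  have d: "(\<phi> has_derivative id) (at 0)"
    using matrix_mult.FDERIV[OF d1 d2] unfolding \<phi>_def id_def by (simp add: P0)
  have "\<exists>M. M \<in> ball 0 (1 / real (Suc n)) \<and> \<phi> M \<in> S \<and> \<phi> M \<notin> mexp ` ?L" for n
  proof -
    \<comment> \<open>As the derivative at 0 is onto, the image of every ball about 0 contains a
      neighbourhood of the identity, so the offending elements of \<open>S\<close> come from
      arguments tending to 0.\<close>
    have "\<phi> 0 \<in> interior (\<phi> ` ball 0 (1 / real (Suc n)))"
      by (rule sussmann_open_mapping[where S = UNIV and f' = id and g' = id])
        (use cont d bounded_linear_ident in \<open>auto simp: id_def\<close>)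
    then obtain e where e: "e > 0" "ball (mat 1) e \<subseteq> \<phi> ` ball 0 (1 / real (Suc n))"
      by (auto simp: mem_interior \<phi>_def P0)
    obtain g where g: "g \<in> S" "dist g (mat 1) < e" "g \<notin> mexp ` ?L"
      using neg e(1) by blast
    then have "g \<in> \<phi> ` ball 0 (1 / real (Suc n))"
      using e(2) by (auto simp: dist_commute)
    with g show ?thesis by blast
  qed
  then obtain M where M: "\<And>n. M n \<in> ball 0 (1 / real (Suc n))" "\<And>n. \<phi> (M n) \<in> S"
      "\<And>n. \<phi> (M n) \<notin> mexp ` ?L"
    by metis
  define y where "y n = M n - P (M n)" for n
  have y_nz: "y n \<noteq> 0" for n
    using M(3)[of n] P(2)[of "M n"] by (auto simp: \<phi>_def y_def)
  have y_S: "mexp (y n) \<in> S" for n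
  proof -
    \<comment> \<open>Cancelling the first factor of \<open>\<phi> (M n)\<close>, which lies in
      \<open>S\<close>, leaves the second.\<close>
    have "mexp (- P (M n)) \<in> S"
      by (intro mexp_lie_algebra lie_algebra_uminus P)
    then have "mexp (- P (M n)) ** \<phi> (M n) \<in> S"
      using S(1) M(2) by (simp add: subgroup_GL_iff)
    then show ?thesis
      by (simp add: \<phi>_def y_def matrix_mul_assoc)
  qed
  have "(\<lambda>n. 1 / real (Suc n)) \<longlonglongrightarrow> 0"
    by (rule LIMSEQ_Suc[OF lim_1_over_n])
  then have "M \<longlonglongrightarrow> 0"
    by (rule Lim_null_comparison[rotated]) (use M(1) in \<open>auto intro!: always_eventually less_imp_le simp: dist_norm\<close>)
  then have "(\<lambda>n. M n - P (M n)) \<longlonglongrightarrow> 0 - P 0"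
    using isCont_tendsto_compose[of 0 P M] contP
    by (intro tendsto_diff) (auto simp: continuous_on_eq_continuous_at)
  then have y_lim: "y \<longlonglongrightarrow> 0"
    by (simp add: y_def[abs_def] P0)
  define v where "v n = y n /\<^sub>R norm (y n)" for n
  have v: "v n \<in> sphere 0 1" for n
    using y_nz by (simp add: v_def)
  obtain u r where u: "u \<in> sphere 0 1" "strict_mono (r :: nat \<Rightarrow> nat)" "(v \<circ> r) \<longlonglongrightarrow> u"
    using compact_sphere[of "0 :: real^'n^'n" 1] v unfolding compact_def by metis
  have "u \<in> ?L"
  proof (rule limit_direction_in_lie_algebra[OF S])
    show "(\<lambda>n. (y \<circ> r) n /\<^sub>R norm ((y \<circ> r) n)) \<longlonglongrightarrow> u"
      using u(3) by (simp add: v_def o_def)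
    show "(y \<circ> r) \<longlonglongrightarrow> 0"
      using y_lim u(2) by (rule LIMSEQ_subseq_LIMSEQ)
  qed (use y_nz y_S in auto)
  \<comment> \<open>Every \<open>v n\<close> is orthogonal to the Lie algebra, which now contains
    their limit \<open>u\<close>; so the unit vector \<open>u\<close> is orthogonal to
    itself.\<close>
  then have "v n \<bullet> u = 0" for n
    using P(3)[of u "M n"] by (simp add: v_def y_def)
  moreover have "(\<lambda>n. (v \<circ> r) n \<bullet> u) \<longlonglongrightarrow> u \<bullet> u"
    by (intro tendsto_inner u tendsto_const)
  ultimately have "u \<bullet> u = 0"
    by (simp add: LIMSEQ_const_iff)
  with u(1) show False by simp
qed

text \<open>That b = a exp x for some x in the Lie algebra is an equivalence relation, by
  commutativity. Translating \<open>mexp_locally_onto\<close> by a shows that its classes in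
  \<open>S\<close> are open, so a connected \<open>S\<close> is a single class.\<close>

lemma connected_commutative_eq_mexp_image:
  fixes S :: "(real^'n^'n) set"
  assumes S: "subgroup S GL" "closed S" "connected S"
    and comm: "\<And>A B. A \<in> S \<Longrightarrow> B \<in> S \<Longrightarrow> A ** B = B ** A"
  shows "S = mexp ` lie_algebra S"
proof
  show "mexp ` lie_algebra S \<subseteq> S"
    by (auto intro: mexp_lie_algebra)
  let ?L = "lie_algebra S"
  note sub = subspace_lie_algebra_commutative[OF S(1) comm]
  obtain e where e: "e > 0" "\<And>g. g \<in> S \<Longrightarrow> dist g (mat 1) < e \<Longrightarrow> g \<in> mexp ` ?L"
    using mexp_locally_onto[OF S(1,2) sub] by blast
  show "S \<subseteq> mexp ` ?L"
  proof
    fix g assume "g \<in> S"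
    have "\<exists>x\<in>?L. g = mat 1 ** mexp x"
    proof (rule connected_equivalence_relation[OF S(3) _ \<open>g \<in> S\<close>,
          where R = "\<lambda>a b. \<exists>x\<in>?L. b = a ** mexp x"])
      show "mat 1 \<in> S"
        using S(1) by (simp add: subgroup_GL_iff)
    next
      fix a b assume "\<exists>x\<in>?L. b = a ** mexp x"
      then obtain x where x: "x \<in> ?L" "b = a ** mexp x" by blast
      then have "a = b ** mexp (- x)"
        by (simp add: matrix_mul_assoc[symmetric])
      with x show "\<exists>x\<in>?L. a = b ** mexp x"
        using lie_algebra_uminus by blast
    next
      fix a b c assume "\<exists>x\<in>?L. b = a ** mexp x" "\<exists>x\<in>?L. c = b ** mexp x"
      then obtain x y where xy: "x \<in> ?L" "b = a ** mexp x" "y \<in> ?L" "c = b ** mexp y" by blast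
      then have "c = a ** mexp (x + y)"
        using mexp_add[OF lie_algebra_commute[OF comm xy(1,3)]] by (simp add: matrix_mul_assoc)
      with xy show "\<exists>x\<in>?L. c = a ** mexp x"
        using subspace_add[OF sub] by blast
    next
      fix a assume a: "a \<in> S"
      then obtain b where b: "b \<in> S" "a ** b = mat 1"
        using S(1) unfolding subgroup_GL_iff by blast
      let ?U = "S \<inter> (\<lambda>h. b ** h) -` ball (mat 1) e"
      have "openin (top_of_set S) ?U"
        by (intro continuous_openin_preimage_gen matrix_mult.continuous_on continuous_intros) auto
      moreover have "a \<in> ?U"
        using a b e(1) matrix_left_right_inverse[of a b] by simp
      moreover have "\<exists>x\<in>?L. h = a ** mexp x" if "h \<in> ?U" for h
      proof -
        have "b ** h \<in> mexp ` ?L"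
          using that b S(1) by (intro e(2)) (auto simp: subgroup_GL_iff dist_commute)
        moreover have "a ** (b ** h) = h"
          using b by (simp add: matrix_mul_assoc)
        ultimately show ?thesis by (auto intro: rev_bexI)
      qed
      ultimately show "\<exists>T. openin (top_of_set S) T \<and> a \<in> T \<and> (\<forall>x\<in>T. \<exists>xa\<in>?L. x = a ** mexp xa)"
        by blast
    qed
    then show "g \<in> mexp ` ?L" by auto
  qed
qed

section \<open>Enlarging a torus, and maximal tori\<close>

lemma torus_closure_extend:
  fixes T G :: "(real^'n^'n) set"
  assumes G: "subgroup G GL" "compact G" and T: "torus_in T G"
    and A: "A \<in> lie_algebra G" "\<And>g. g \<in> T \<Longrightarrow> A ** g = g ** A"
  shows "torus_in (closure {g ** mexp (s *\<^sub>R A) | g s. g \<in> T}) G"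
proof -
  \<comment> \<open>The products of \<open>T\<close> with the one-parameter group of
    \<open>A\<close> form a commutative subgroup of \<open>G\<close>, connected as a continuous
    image of T x R. These properties pass to the closure, which is compact inside
    \<open>G\<close>.\<close>
  define M where "M = {g ** mexp (s *\<^sub>R A) | g s. g \<in> T}"
  have TG: "T \<subseteq> G" "subgroup T GL" "connected T"
    and Tc: "\<And>g h. g \<in> T \<Longrightarrow> h \<in> T \<Longrightarrow> g ** h = h ** g"
    using T by (auto simp: torus_in_def comm_group_GL_iff)
  have cm: "mexp (s *\<^sub>R A) ** g = g ** mexp (s *\<^sub>R A)" if "g \<in> T" for g s
    by (rule mexp_scaleR_commute) (rule A(2)[OF that])
  have mult: "(g ** mexp (s *\<^sub>R A)) ** (h ** mexp (t *\<^sub>R A)) = (g ** h) ** mexp ((s + t) *\<^sub>R A)"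
    if "h \<in> T" for g h s t
    by (metis cm that matrix_mul_assoc mexp_scaleR_add)
  have MG: "M \<subseteq> G"
    using TG(1) A(1) G(1) by (auto simp: M_def lie_algebra_def subgroup_GL_iff)
  then have clG: "closure M \<subseteq> G"
    using G(2) by (simp add: closure_minimal compact_imp_closed)
  have M1: "mat 1 \<in> M"
    using TG(2) unfolding M_def subgroup_GL_iff
    by (auto intro!: exI[of _ "mat 1"] exI[of _ "0::real"])
  have Mm: "a ** b \<in> M" if ab: "a \<in> M" "b \<in> M" for a b
  proof -
    obtain g s h t where "a = g ** mexp (s *\<^sub>R A)" "g \<in> T" "b = h ** mexp (t *\<^sub>R A)" "h \<in> T"
      using ab by (auto simp: M_def)
    then show ?thesis
      using TG(2) mult[of h g s t] unfolding M_def subgroup_GL_iff by blast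
  qed
  have Mc: "a ** b = b ** a" if ab: "a \<in> M" "b \<in> M" for a b
  proof -
    obtain g s h t where "a = g ** mexp (s *\<^sub>R A)" "g \<in> T" "b = h ** mexp (t *\<^sub>R A)" "h \<in> T"
      using ab by (auto simp: M_def)
    then show ?thesis
      using Tc[of g h] mult[of h g s t] mult[of g h t s] by (simp add: add.commute)
  qed
  have Mi: "\<exists>b\<in>M. a ** b = mat 1" if a: "a \<in> M" for a
  proof -
    obtain g s where gs: "a = g ** mexp (s *\<^sub>R A)" "g \<in> T"
      using a by (auto simp: M_def)
    then obtain h where h: "h \<in> T" "g ** h = mat 1"
      using TG(2) unfolding subgroup_GL_iff by blast
    then have "a ** (h ** mexp ((- s) *\<^sub>R A)) = mat 1"
      unfolding gs(1) mult[OF h(1)] by simp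
    with h(1) show ?thesis
      unfolding M_def by blast
  qed
  have sub: "subgroup (closure M) GL"
    unfolding subgroup_GL_iff
  proof (intro conjI ballI)
    show "mat 1 \<in> closure M"
      using M1 closure_subset by blast
    fix a assume "a \<in> closure M"
    then obtain f where f: "\<And>n. f n \<in> M" "f \<longlonglongrightarrow> a"
      by (auto simp: closure_sequential)
    show "a ** b \<in> closure M" if b: "b \<in> closure M" for b
    proof -
      obtain f' where f': "\<And>n. f' n \<in> M" "f' \<longlonglongrightarrow> b"
        using b unfolding closure_sequential by blast
      have "(\<lambda>n. f n ** f' n) \<longlonglongrightarrow> a ** b"
        by (rule matrix_mult.tendsto[OF f(2) f'(2)])
      then show ?thesis
        unfolding closure_sequential using Mm[OF f(1) f'(1)]
        by (intro exI[of _ "\<lambda>n. f n ** f' n"] conjI allI)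
    qed
    have "\<forall>n. \<exists>b. b \<in> M \<and> f n ** b = mat 1"
      using Mi[OF f(1)] by blast
    then obtain h where h: "\<And>n. h n \<in> M" "\<And>n. f n ** h n = mat 1"
      unfolding choice_iff by blast
    \<comment> \<open>Compactness of \<open>G\<close> makes a subsequence of the inverses converge,
      and its limit is inverse to \<open>a\<close>.\<close>
    then have "\<And>n. h n \<in> G" using MG by blast
    then obtain b r where b: "strict_mono (r :: nat \<Rightarrow> nat)" "(h \<circ> r) \<longlonglongrightarrow> b"
      using G(2) unfolding compact_def by metis
    have "(\<lambda>n. (f \<circ> r) n ** (h \<circ> r) n) \<longlonglongrightarrow> a ** b"
      by (rule matrix_mult.tendsto[OF LIMSEQ_subseq_LIMSEQ[OF f(2) b(1)] b(2)])
    then have "a ** b = mat 1"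
      using h(2) by (simp add: LIMSEQ_const_iff)
    moreover have "b \<in> closure M"
      unfolding closure_sequential using b(2) h(1) by (intro exI[of _ "h \<circ> r"]) auto
    ultimately show "\<exists>b\<in>closure M. a ** b = mat 1" by blast
  qed
  have comm: "a ** b = b ** a" if ab: "a \<in> closure M" "b \<in> closure M" for a b
  proof -
    obtain f f' where f: "\<And>n. f n \<in> M" "f \<longlonglongrightarrow> a" "\<And>n. f' n \<in> M" "f' \<longlonglongrightarrow> b"
      using ab by (auto simp: closure_sequential)
    have "(\<lambda>n. f n ** f' n) \<longlonglongrightarrow> a ** b" "(\<lambda>n. f n ** f' n) \<longlonglongrightarrow> b ** a"
      using matrix_mult.tendsto[OF f(2) f(4)] matrix_mult.tendsto[OF f(4) f(2)] f(1,3) Mc by auto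
    then show ?thesis by (rule LIMSEQ_unique)
  qed
  have "connected M"
  proof -
    have "M = (\<lambda>(g, s). g ** mexp (s *\<^sub>R A)) ` (T \<times> UNIV)"
      by (auto simp: M_def)
    moreover have "connected (T \<times> (UNIV :: real set))"
      using TG(3) by (intro connected_Times) auto
    moreover have "continuous_on (T \<times> UNIV) (\<lambda>(g, s). g ** mexp (s *\<^sub>R A))"
      unfolding case_prod_beta
      by (intro matrix_mult.continuous_on continuous_on_compose2[OF continuous_on_mexp] continuous_intros) auto
    ultimately show ?thesis
      by (simp add: connected_continuous_image)
  qed
  then have "connected (closure M)"
    by (rule connected_imp_connected_closure)
  moreover have "compact (closure M)"
    using clG G(2) by (metis closed_closure closed_Int_compact inf.absorb1)
  ultimately have "torus_in (closure M) G"
    using sub clG comm by (simp add: torus_in_def comm_group_GL_iff)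
  then show ?thesis
    by (simp add: M_def)
qed

text \<open>\<open>T\<close> is the exponential image of its Lie algebra, so \<open>A\<close>
  commutes with all of \<open>T\<close>. Adjoining the one-parameter group of \<open>A\<close> gives
  a torus containing \<open>T\<close>, which by maximality is \<open>T\<close>.\<close>

lemma maximal_torus_lie_algebra_self_centralizing:
  fixes T G :: "(real^'n^'n) set"
  assumes G: "subgroup G GL" "compact G" and T: "maximal_torus T G"
    and A: "A \<in> lie_algebra G" "\<And>H. H \<in> lie_algebra T \<Longrightarrow> A ** H = H ** A"
  shows "A \<in> lie_algebra T"
proof -
  have tor: "torus_in T G" and max: "\<And>T'. torus_in T' G \<Longrightarrow> T \<subseteq> T' \<Longrightarrow> T' = T"
    using T by (auto simp: maximal_torus_def)
  have "T = mexp ` lie_algebra T"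
    by (rule connected_commutative_eq_mexp_image)
      (use tor in \<open>auto simp: torus_in_def comm_group_GL_iff compact_imp_closed\<close>)
  then have Ag: "A ** g = g ** A" if "g \<in> T" for g
    using that A(2) mexp_commute[of _ A] by (metis (no_types, opaque_lifting) imageE)
  let ?M = "{g ** mexp (s *\<^sub>R A) | g s. g \<in> T}"
  have "T \<subseteq> ?M"
    by (force intro: exI[of _ "0::real"])
  then have "closure ?M = T"
    using closure_subset by (intro max torus_closure_extend[OF G tor A(1) Ag]) blast+
  moreover have "mexp (s *\<^sub>R A) \<in> ?M" for s
    using tor by (force simp: torus_in_def subgroup_GL_iff intro: exI[of _ "mat 1"])
  ultimately show ?thesis
    using closure_subset[of ?M] by (auto simp: lie_algebra_def)
qed

section \<open>The Lie algebra of a linear algebraic group\<close>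

lemma mscale_nth [simp]: "mscale c A $ i $ j = c * A $ i $ j"
  by (simp add: mscale_def)

lemma scaleR_eq_mscale: "t *\<^sub>R A = mscale (of_real t) A"
  unfolding mscale_def by (rule scaleR_eq_map_matrix)

lemma mscale_matrix_mult_left: "mscale c A ** B = mscale c (A ** B)"
  by (simp add: vec_eq_iff matrix_matrix_mult_def sum_distrib_left mult_ac)

lemma mscale_matrix_mult_right: "A ** mscale c B = mscale c (A ** B)"
  by (simp add: vec_eq_iff matrix_matrix_mult_def sum_distrib_left mult_ac)

text \<open>The left invariant vector field determined by \<open>X\<close>, as a derivation of polynomial functions.\<close>

definition invariant_deriv ::
  "complex^'n^'n \<Rightarrow> (complex^'n^'n \<Rightarrow> complex) \<Rightarrow> complex^'n^'n \<Rightarrow> complex" where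
  "invariant_deriv X p A = deriv (\<lambda>c. p (A + mscale c (A ** X))) 0"

section \<open>Left invariant derivations of polynomial functions\<close>

lemma matrix_poly_differentiable_line:
  assumes "p \<in> matrix_poly UNIV"
  shows "(\<lambda>c. p (A + mscale c B)) field_differentiable at z"
  using assms by induction (auto intro!: derivative_intros field_differentiable_add field_differentiable_mult)

lemma invariant_deriv_const [simp]: "invariant_deriv X (\<lambda>A. c) = (\<lambda>A. 0)"
  by (simp add: invariant_deriv_def fun_eq_iff)

text \<open>The factor \<open>Y\<close> makes the formula iterable: deriving an entry of
  \<open>A\<close> gives an entry of \<open>A ** X\<close>, to which another derivation can be
  applied.\<close>

lemma invariant_deriv_entry_mult [simp]:
  fixes X Y :: "complex^'n^'n"
  shows "invariant_deriv X (\<lambda>A. (A ** Y) $ i $ j) = (\<lambda>A. (A ** X ** Y) $ i $ j)"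
proof
  fix A
  have "((A + mscale c (A ** X)) ** Y) $ i $ j = (A ** Y) $ i $ j + c * (A ** X ** Y) $ i $ j" for c
    by (simp add: matrix_mult.add_left mscale_matrix_mult_left)
  then show "invariant_deriv X (\<lambda>A. (A ** Y) $ i $ j) A = (A ** X ** Y) $ i $ j"
    unfolding invariant_deriv_def by (auto intro!: DERIV_imp_deriv derivative_eq_intros)
qed

lemma invariant_deriv_entry [simp]:
  "invariant_deriv X (\<lambda>A. A $ i $ j) = (\<lambda>A. (A ** X) $ i $ j)"
  using invariant_deriv_entry_mult[of X "mat 1" i j] by simp

lemma invariant_deriv_add:
  "p \<in> matrix_poly UNIV \<Longrightarrow> q \<in> matrix_poly UNIV \<Longrightarrow>
    invariant_deriv X (\<lambda>A. p A + q A) = (\<lambda>A. invariant_deriv X p A + invariant_deriv X q A)"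
  by (simp add: fun_eq_iff invariant_deriv_def matrix_poly_differentiable_line)

lemma invariant_deriv_mult:
  "p \<in> matrix_poly UNIV \<Longrightarrow> q \<in> matrix_poly UNIV \<Longrightarrow>
    invariant_deriv X (\<lambda>A. p A * q A) = (\<lambda>A. invariant_deriv X p A * q A + p A * invariant_deriv X q A)"
  by (simp add: fun_eq_iff invariant_deriv_def matrix_poly_differentiable_line)

lemma matrix_poly_sum:
  "finite I \<Longrightarrow> (\<And>k. k \<in> I \<Longrightarrow> p k \<in> matrix_poly UNIV) \<Longrightarrow> (\<lambda>A. \<Sum>k\<in>I. p k A) \<in> matrix_poly UNIV"
  by (induction I rule: finite_induct) (auto intro: matrix_poly.intros)

lemma matrix_poly_entry_mult: "(\<lambda>A. (A ** X) $ i $ j) \<in> matrix_poly UNIV"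
  unfolding matrix_matrix_mult_def vec_lambda_beta
  by (intro matrix_poly_sum matrix_poly.intros) auto

lemma invariant_deriv_matrix_poly:
  "p \<in> matrix_poly UNIV \<Longrightarrow> invariant_deriv X p \<in> matrix_poly UNIV"
  by (induction rule: matrix_poly.induct)
    (auto simp: invariant_deriv_add invariant_deriv_mult matrix_poly_entry_mult intro!: matrix_poly.intros)

lemma invariant_deriv_chain:
  assumes "p \<in> matrix_poly UNIV"
    and F: "\<And>i j. ((\<lambda>c. F c $ i $ j) has_field_derivative (F z ** X) $ i $ j) (at z)"
  shows "((\<lambda>c. p (F c)) has_field_derivative invariant_deriv X p (F z)) (at z)"
  using assms(1)
proof induction
  case (mult p q)
  then show ?case
    by (auto simp: invariant_deriv_mult intro!: derivative_eq_intros)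
qed (auto simp: invariant_deriv_add intro!: F derivative_intros)

text \<open>The curve A exp (c X) is the integral curve of the field through \<open>A\<close>,
  because \<open>X\<close> commutes with its own exponential.\<close>

lemma invariant_deriv_mexp:
  assumes "p \<in> matrix_poly UNIV"
  shows "((\<lambda>c. p (A ** mexp (mscale c X))) has_field_derivative
           invariant_deriv X p (A ** mexp (mscale z X))) (at z)"
proof (rule invariant_deriv_chain[OF assms])
  fix i j
  have "X ** mexp (mscale z X) = mexp (mscale z X) ** X"
    by (rule mexp_commute[symmetric]) (simp add: mscale_matrix_mult_left mscale_matrix_mult_right)
  then have "A ** mexp (mscale z X) ** X = A ** (X ** mexp (mscale z X))"
    by (simp add: matrix_mul_assoc)
  moreover have "((\<lambda>c. (A ** mexp (mscale c X)) $ i $ j) has_field_derivative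
      (A ** (X ** mexp (mscale z X))) $ i $ j) (at z)"
    unfolding matrix_matrix_mult_def[of A] vec_lambda_beta mscale_def
    by (intro DERIV_sum DERIV_cmult mexp_scale_entry_DERIV)
  ultimately show "((\<lambda>c. (A ** mexp (mscale c X)) $ i $ j) has_field_derivative
      (A ** mexp (mscale z X) ** X) $ i $ j) (at z)"
    by simp
qed

lemma invariant_deriv_add_field:
  assumes "p \<in> matrix_poly UNIV"
  shows "invariant_deriv (X + Y) p = (\<lambda>A. invariant_deriv X p A + invariant_deriv Y p A)"
  using assms by induction
    (auto simp: invariant_deriv_add invariant_deriv_mult matrix_mult.add_right algebra_simps)

lemma invariant_deriv_mscale_field:
  assumes "p \<in> matrix_poly UNIV"
  shows "invariant_deriv (mscale c X) p = (\<lambda>A. c * invariant_deriv X p A)"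
  using assms by induction
    (auto simp: invariant_deriv_add invariant_deriv_mult mscale_matrix_mult_right algebra_simps)

text \<open>Both sides are derivations in \<open>p\<close>, the mixed first order terms cancelling
  in the commutator, so only entries need to be compared.\<close>

lemma invariant_deriv_lie_bracket:
  assumes "p \<in> matrix_poly UNIV"
  shows "invariant_deriv (lie_bracket X Y) p =
    (\<lambda>A. invariant_deriv X (invariant_deriv Y p) A - invariant_deriv Y (invariant_deriv X p) A)"
  using assms
proof induction
  case (entry i j)
  show ?case
    by (simp add: lie_bracket_def matrix_mult.diff_right matrix_mul_assoc)
next
  case (add p q)
  then show ?case
    by (simp add: invariant_deriv_add invariant_deriv_matrix_poly algebra_simps)
next
  case (mult p q)
  then show ?case
    by (simp add: invariant_deriv_add invariant_deriv_mult invariant_deriv_matrix_poly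
        matrix_poly.mult algebra_simps)
qed simp

section \<open>The vanishing ideal and the Lie algebra\<close>

definition vanishing_ideal :: "(complex^'n^'n) set \<Rightarrow> (complex^'n^'n \<Rightarrow> complex) set" where
  "vanishing_ideal G = {p \<in> matrix_poly UNIV. \<forall>A\<in>G. p A = 0}"

text \<open>For A in \<open>G\<close> the function p (A exp (t X)) of real t vanishes identically,
  hence so does its derivative at 0.\<close>

lemma invariant_deriv_vanishing_ideal:
  assumes G: "subgroup G GL" and X: "X \<in> lie_algebra G" and p: "p \<in> vanishing_ideal G"
  shows "invariant_deriv X p \<in> vanishing_ideal G"
proof -
  have poly: "p \<in> matrix_poly UNIV"
    using p by (simp add: vanishing_ideal_def)
  have "invariant_deriv X p A = 0" if A: "A \<in> G" for A
  proof -
    have "((\<lambda>t. p (A ** mexp (mscale (of_real t) X))) has_vector_derivative invariant_deriv X p A) (at 0)"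
      using field_vector_diff_chain_at[OF has_vector_derivative_of_real[OF DERIV_ident]
          invariant_deriv_mexp[OF poly, of A X "of_real 0"]]
      by (simp add: o_def)
    moreover have "p (A ** mexp (mscale (of_real t) X)) = 0" for t :: real
      using X A G p by (simp add: lie_algebra_def scaleR_eq_mscale subgroup_GL_iff vanishing_ideal_def)
    ultimately show ?thesis
      using vector_derivative_unique_at[OF _ has_vector_derivative_const] by simp
  qed
  then show ?thesis
    by (simp add: vanishing_ideal_def invariant_deriv_matrix_poly poly)
qed

text \<open>All derivatives of \<open>p (exp (c X))\<close> at \<open>c = 0\<close> vanish, and this function of \<open>c\<close> is entire.\<close>

lemma mexp_vanishing_ideal:
  assumes "mat 1 \<in> G" and X: "\<And>q. q \<in> vanishing_ideal G \<Longrightarrow> invariant_deriv X q \<in> vanishing_ideal G"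
    and p: "p \<in> vanishing_ideal G"
  shows "p (mexp (mscale c X)) = 0"
proof -
  have mem: "(invariant_deriv X ^^ n) p \<in> vanishing_ideal G" for n
    by (induction n) (use p X in auto)
  then have poly: "(invariant_deriv X ^^ n) p \<in> matrix_poly UNIV" for n
    by (simp add: vanishing_ideal_def)
  have der: "((\<lambda>c. (invariant_deriv X ^^ n) p (mexp (mscale c X))) has_field_derivative
      (invariant_deriv X ^^ Suc n) p (mexp (mscale z X))) (at z)" for n z
    using invariant_deriv_mexp[OF poly[of n], of "mat 1" X z] by simp
  have iter: "(deriv ^^ n) (\<lambda>c. p (mexp (mscale c X))) = (\<lambda>c. (invariant_deriv X ^^ n) p (mexp (mscale c X)))" for n
  proof (induction n)
    case (Suc n)
    show ?case
      unfolding funpow.simps o_apply Suc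
      using DERIV_imp_deriv[OF der[of n]] by (simp add: fun_eq_iff)
  qed simp
  have m0: "mexp (mscale 0 X) = mat 1"
    by (simp only: cmat.scale_zero_left mexp_0)
  show ?thesis
  proof (rule holomorphic_fun_eq_0_on_connected[where S = UNIV and z = 0 and w = c
        and f = "\<lambda>c. p (mexp (mscale c X))"])
    show "(\<lambda>c. p (mexp (mscale c X))) holomorphic_on UNIV"
      using der[of 0] by (auto simp: holomorphic_on_def field_differentiable_def)
    fix n
    show "(deriv ^^ n) (\<lambda>c. p (mexp (mscale c X))) 0 = 0"
      using mem[of n] assms(1) unfolding iter m0 by (simp add: vanishing_ideal_def)
  qed auto
qed

text \<open>Recasts membership as a condition visibly stable under complex linear combinations and
  brackets, which the definition by real one-parameter groups is not.\<close>

lemma lie_algebra_algebraic_group_iff: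
  assumes "linear_algebraic_group G"
  shows "X \<in> lie_algebra G \<longleftrightarrow> (\<forall>p\<in>vanishing_ideal G. invariant_deriv X p \<in> vanishing_ideal G)"
proof
  show "X \<in> lie_algebra G \<Longrightarrow> \<forall>p\<in>vanishing_ideal G. invariant_deriv X p \<in> vanishing_ideal G"
    using assms invariant_deriv_vanishing_ideal by (auto simp: linear_algebraic_group_def)
  assume X: "\<forall>p\<in>vanishing_ideal G. invariant_deriv X p \<in> vanishing_ideal G"
  obtain P where P: "P \<subseteq> matrix_poly UNIV" "G = {A \<in> carrier GL. \<forall>p\<in>P. p A = 0}"
    using assms by (auto simp: linear_algebraic_group_def zariski_closed_def)
  have "mat 1 \<in> G"
    using assms by (simp add: linear_algebraic_group_def subgroup_GL_iff)
  moreover have "P \<subseteq> vanishing_ideal G"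
    using P by (auto simp: vanishing_ideal_def)
  ultimately have "p (mexp (mscale c X)) = 0" if "p \<in> P" for p c
    using mexp_vanishing_ideal[of G X p c] X that by blast
  moreover have "mexp (mscale c X) \<in> carrier GL" for c
    by (simp add: GL_def)
  ultimately show "X \<in> lie_algebra G"
    unfolding lie_algebra_def scaleR_eq_mscale by (subst P(2)) simp
qed

lemma subspace_lie_algebra:
  assumes G: "linear_algebraic_group G"
  shows "cmat.subspace (lie_algebra G)"
proof -
  let ?I = "vanishing_ideal G"
  have poly: "p \<in> matrix_poly UNIV" if "p \<in> ?I" for p
    using that by (simp add: vanishing_ideal_def)
  show ?thesis
  proof (rule cmat.subspaceI)
    show "0 \<in> lie_algebra G"
      using G by (simp add: lie_algebra_def linear_algebraic_group_def subgroup_GL_iff)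
    show "X + Y \<in> lie_algebra G" if XY: "X \<in> lie_algebra G" "Y \<in> lie_algebra G" for X Y
      unfolding lie_algebra_algebraic_group_iff[OF G]
    proof
      fix p assume p: "p \<in> ?I"
      then have "invariant_deriv X p \<in> ?I" "invariant_deriv Y p \<in> ?I"
        using XY by (auto simp: lie_algebra_algebraic_group_iff[OF G])
      then show "invariant_deriv (X + Y) p \<in> ?I"
        by (simp add: vanishing_ideal_def invariant_deriv_add_field[OF poly[OF p]] matrix_poly.add)
    qed
    show "mscale c X \<in> lie_algebra G" if X: "X \<in> lie_algebra G" for c X
      unfolding lie_algebra_algebraic_group_iff[OF G]
    proof
      fix p assume p: "p \<in> ?I"
      then have "invariant_deriv X p \<in> ?I"
        using X by (auto simp: lie_algebra_algebraic_group_iff[OF G])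
      then show "invariant_deriv (mscale c X) p \<in> ?I"
        by (simp add: vanishing_ideal_def invariant_deriv_mscale_field[OF poly[OF p]] matrix_poly.intros)
    qed
  qed
qed

lemma lie_bracket_lie_algebra:
  assumes G: "linear_algebraic_group G" and "X \<in> lie_algebra G" "Y \<in> lie_algebra G"
  shows "lie_bracket X Y \<in> lie_algebra G"
  unfolding lie_algebra_algebraic_group_iff[OF G]
proof
  fix p assume p: "p \<in> vanishing_ideal G"
  then have poly: "p \<in> matrix_poly UNIV"
    by (simp add: vanishing_ideal_def)
  have "invariant_deriv X (invariant_deriv Y p) \<in> vanishing_ideal G"
    "invariant_deriv Y (invariant_deriv X p) \<in> vanishing_ideal G"
    using assms p by (auto simp: lie_algebra_algebraic_group_iff[OF G])
  then show "invariant_deriv (lie_bracket X Y) p \<in> vanishing_ideal G"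
    by (simp add: vanishing_ideal_def invariant_deriv_lie_bracket[OF poly, of X Y, THEN fun_cong]
        invariant_deriv_matrix_poly[OF poly])
qed

section \<open>Compact real forms\<close>

lemma conj_mat_nth [simp]: "conj_mat A $ i $ j = cnj (A $ i $ j)"
  by (simp add: conj_mat_def)

lemma complexify_nth [simp]: "complexify A $ i $ j = of_real (A $ i $ j)"
  by (simp add: complexify_def)

lemma conj_mat_conj_mat [simp]: "conj_mat (conj_mat A) = A"
  by (simp add: vec_eq_iff)

lemma conj_mat_add: "conj_mat (A + B) = conj_mat A + conj_mat B"
  by (simp add: vec_eq_iff)

lemma conj_mat_uminus: "conj_mat (- A) = - conj_mat A"
  by (simp add: vec_eq_iff)

lemma conj_mat_diff: "conj_mat (A - B) = conj_mat A - conj_mat B"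
  by (simp add: vec_eq_iff)

lemma conj_mat_matrix_mult: "conj_mat (A ** B) = conj_mat A ** conj_mat B"
  by (simp add: vec_eq_iff matrix_matrix_mult_def)

lemma conj_mat_mat_1 [simp]: "conj_mat (mat 1) = mat 1"
  by (simp add: vec_eq_iff mat_def)

lemma conj_mat_lie_bracket:
  "conj_mat (lie_bracket A B) = lie_bracket (conj_mat A) (conj_mat B)"
  by (simp add: lie_bracket_def conj_mat_diff conj_mat_matrix_mult)

lemma conj_mat_mexp: "conj_mat (mexp A) = mexp (conj_mat A)"
  unfolding conj_mat_def by (rule map_matrix_mexp) (auto intro: bounded_linear_cnj)

lemma complexify_0 [simp]: "complexify 0 = 0"
  by (simp add: vec_eq_iff)

lemma complexify_add: "complexify (A + B) = complexify A + complexify B"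
  by (simp add: vec_eq_iff)

lemma complexify_scaleR: "complexify (r *\<^sub>R A) = r *\<^sub>R complexify A"
  by (simp add: vec_eq_iff scaleR_conv_of_real[where 'a=complex])

lemma complexify_matrix_mult: "complexify (A ** B) = complexify A ** complexify B"
  by (simp add: vec_eq_iff matrix_matrix_mult_def)

lemma complexify_eq_iff [simp]: "complexify A = complexify B \<longleftrightarrow> A = B"
  by (simp add: vec_eq_iff)

lemma norm_complexify [simp]: "norm (complexify A) = norm A"
  by (simp add: norm_vec_def)

lemma complexify_mexp: "complexify (mexp A) = mexp (complexify A)"
  unfolding complexify_def by (rule map_matrix_mexp) (auto intro: bounded_linear_of_real)

lemma matrix_poly_real_conj:
  "p \<in> matrix_poly \<real> \<Longrightarrow> p (conj_mat A) = cnj (p A)"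
  by (induction rule: matrix_poly.induct) (auto simp: Reals_cnj_iff)

text \<open>The defining equations have real coefficients, so conjugation permutes their common
  zeros.\<close>

lemma conj_mat_extension_of_scalars:
  assumes "A \<in> extension_of_scalars GR"
  shows "conj_mat A \<in> extension_of_scalars GR"
proof -
  have "invertible A"
    using assms by (simp add: extension_of_scalars_def GL_def)
  then obtain B where "A ** B = mat 1" "B ** A = mat 1"
    unfolding invertible_def by blast
  then have "conj_mat A ** conj_mat B = mat 1" "conj_mat B ** conj_mat A = mat 1"
    by (simp_all flip: conj_mat_matrix_mult)
  then have "invertible (conj_mat A)"
    unfolding invertible_def by blast
  then show ?thesis
    using assms by (simp add: extension_of_scalars_def GL_def matrix_poly_real_conj)
qed

lemma conj_mat_lie_algebra:
  assumes "compact_real_form GR GC" "X \<in> lie_algebra GC"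
  shows "conj_mat X \<in> lie_algebra GC"
proof -
  have "mexp (t *\<^sub>R conj_mat X) = conj_mat (mexp (t *\<^sub>R X))" for t
    by (simp add: conj_mat_mexp scaleR_eq_mscale conj_mat_mscale)
  then show ?thesis
    using assms conj_mat_extension_of_scalars unfolding lie_algebra_def compact_real_form_def
    by fastforce
qed

text \<open>\<open>GR\<close> consists of exactly the real points of \<open>GC\<close>, and
  complexification commutes with the exponential.\<close>

lemma complexify_lie_algebra_iff:
  assumes "compact_real_form GR GC"
  shows "complexify A \<in> lie_algebra GC \<longleftrightarrow> A \<in> lie_algebra GR"
proof -
  have "B \<in> GR \<longleftrightarrow> complexify B \<in> GC" for B
    using assms unfolding compact_real_form_def by blast
  then show ?thesis
    by (simp add: lie_algebra_def complexify_mexp flip: complexify_scaleR)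
qed

section \<open>Matrices with bounded one-parameter group\<close>

text \<open>The trace of an idempotent is its rank. Here \<open>E\<close> is compared with the
  orthogonal projection \<open>M\<close> onto its range: \<open>M ** E = E\<close> and
  \<open>E ** M = M\<close> give equal traces, and the trace of the symmetric idempotent
  \<open>M\<close> is the sum of the squares of its entries.\<close>

lemma trace_idempotent_eq_0:
  fixes E :: "real^'n^'n"
  assumes idem: "E ** E = E" and tr: "trace E = 0"
  shows "E = 0"
proof -
  let ?L = "range ((*v) E)"
  have "subspace ?L"
    using subspace_UNIV matrix_vector_mul_linear by (rule linear_subspace_image[rotated])
  then obtain P where P: "linear P" "\<And>x. P x \<in> ?L" "\<And>x y. y \<in> ?L \<Longrightarrow> (x - P x) \<bullet> y = 0"
    using orthogonal_projection_exists by blast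
  have fix_P: "P z = z" if "z \<in> ?L" for z
  proof -
    have "(z - P z) \<bullet> z = 0" "(z - P z) \<bullet> P z = 0"
      using P(2,3) that by auto
    then have "(z - P z) \<bullet> (z - P z) = 0"
      by (simp add: inner_diff_right)
    then show ?thesis by simp
  qed
  have sym: "P x \<bullet> y = P y \<bullet> x" for x y
    using P(3)[OF P(2), of x y] P(3)[OF P(2), of y x]
    by (simp add: inner_diff_left) (metis inner_commute)
  define M where "M = matrix P"
  have M: "M *v x = P x" for x
    unfolding M_def by (simp add: P(1))
  have ME: "M ** E = E"
    unfolding matrix_eq by (simp add: M fix_P flip: matrix_vector_mul_assoc)
  have EM: "E ** M = M"
    unfolding matrix_eq
  proof
    fix x
    obtain w where w: "P x = E *v w"
      using P(2)[of x] by blast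
    then show "E ** M *v x = M *v x"
      by (simp add: M idem matrix_vector_mul_assoc flip: matrix_vector_mul_assoc[of E M])
  qed
  have MM: "M ** M = M"
    unfolding matrix_eq by (simp add: M fix_P P(2) flip: matrix_vector_mul_assoc)
  have Msym: "M $ i $ j = M $ j $ i" for i j
    using sym[of "axis j 1" "axis i 1"] by (simp add: M_def matrix_def inner_axis)
  have "trace M = 0"
    using trace_mul_sym[of M E] tr by (simp add: ME EM)
  then have "trace (M ** M) = 0"
    by (simp add: MM)
  then have "(\<Sum>i\<in>UNIV. \<Sum>k\<in>UNIV. (M $ i $ k)\<^sup>2) = 0"
    by (simp add: trace_def matrix_matrix_mult_def Msym power2_eq_square)
  then have "M = 0"
    by (simp add: sum_nonneg_eq_0_iff sum_nonneg vec_eq_iff)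
  then show ?thesis
    using ME by simp
qed

lemma linear_bounded_above_imp_eq_0:
  fixes a b :: real
  assumes "\<And>t. t * a \<le> b"
  shows "a = 0"
proof (rule ccontr)
  assume "a \<noteq> 0"
  then show False
    using assms[of "(b + 1) / a"] by simp
qed

text \<open>If A A R = 0, then R + t A R equals exp (t A) R by uniqueness for the linear equation,
  and a bounded affine function of t is constant. So \<open>A\<close> has no nilpotent part at the
  eigenvalue 0.\<close>

lemma bounded_mexp_kernel:
  fixes A R :: "real^'n^'n"
  assumes K: "\<And>t. norm (mexp (t *\<^sub>R A)) \<le> K" and AAR: "A ** (A ** R) = 0"
  shows "A ** R = 0"
proof -
  have eq: "R + t *\<^sub>R (A ** R) = mexp (t *\<^sub>R A) ** R" for t
  proof -
    have "((\<lambda>t. R + t *\<^sub>R (A ** R)) has_vector_derivative A ** (R + t *\<^sub>R (A ** R))) (at t)" for t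
      by (auto simp: matrix_mult.add_right matrix_mult_scaleR_right AAR intro!: derivative_eq_intros)
    from mexp_ODE_unique[of "\<lambda>t. R + t *\<^sub>R (A ** R)", OF this, of t] show ?thesis by simp
  qed
  have "t * norm (A ** R) \<le> (K + 1) * norm R" for t
  proof -
    have "t * norm (A ** R) \<le> norm (t *\<^sub>R (A ** R))"
      by (simp add: mult_right_mono)
    also have "t *\<^sub>R (A ** R) = mexp (t *\<^sub>R A) ** R - R"
      using eq[of t] by (simp add: algebra_simps)
    also have "norm \<dots> \<le> norm (mexp (t *\<^sub>R A) ** R) + norm R"
      by (rule norm_triangle_ineq4)
    also have "norm (mexp (t *\<^sub>R A) ** R) \<le> K * norm R"
      by (rule order_trans[OF norm_matrix_mult_le mult_right_mono[OF K]]) simp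
    finally show ?thesis by (simp add: algebra_simps)
  qed
  from linear_bounded_above_imp_eq_0[OF this] show ?thesis by simp
qed

text \<open>Multiplication by \<open>A\<close> is injective, hence onto, on \<open>A C\<close>, which yields an idempotent
  \<open>E \<in> A C\<close> with \<open>A = A E\<close>; being of trace zero, it vanishes.\<close>

lemma bounded_mexp_trace_eq_0:
  fixes A :: "real^'n^'n"
  assumes K: "\<And>t. norm (mexp (t *\<^sub>R A)) \<le> K"
    and C: "subspace C" "mat 1 \<in> C" "A \<in> C" "\<And>R S. R \<in> C \<Longrightarrow> S \<in> C \<Longrightarrow> R ** S \<in> C"
    and tr: "\<And>R. R \<in> C \<Longrightarrow> trace (A ** R) = 0"
  shows "A = 0"
proof -
  let ?f = "(**) A" and ?S = "(**) A ` C"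
  note ker = bounded_mexp_kernel[OF K]
  have lin: "linear ?f"
    by (rule bounded_linear.linear[OF matrix_mult.bounded_linear_right])
  have S: "subspace ?S"
    by (rule linear_subspace_image[OF lin C(1)])
  have "inj_on ?f (span ?S)"
    unfolding span_eq_iff[THEN iffD2, OF S] linear_inj_on_iff_eq_0[OF lin S]
    using ker by blast
  then have "dim (?f ` ?S) = dim ?S"
    by (rule dim_image_eq[OF lin])
  moreover have "?f ` ?S \<subseteq> ?S"
    using C(3,4) by blast
  ultimately have "?f ` ?S = ?S"
    by (intro subspace_dim_equal linear_subspace_image[OF lin] S) auto
  moreover have "A \<in> ?S"
    using C(2) by (intro image_eqI[of _ _ "mat 1"]) auto
  ultimately have "A \<in> ?f ` ?S" by simp
  then obtain R where R: "R \<in> C" "A = A ** (A ** R)"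
    by blast
  define E where "E = A ** R"
  have AE: "A ** E = A"
    using R(2) by (simp add: E_def)
  \<comment> \<open>The kernel lemma is used a second time, to cancel a factor \<open>A\<close> from
    A A R E = A A R and obtain E E = E.\<close>
  have "A ** (A ** (R ** E - R)) = A ** E ** E - A ** E"
    by (simp add: E_def matrix_mult.diff_right matrix_mul_assoc)
  then have "A ** (A ** (R ** E - R)) = 0"
    by (simp add: AE)
  then have "A ** (R ** E - R) = 0"
    by (rule ker)
  then have "E ** E = E"
    by (simp add: E_def matrix_mult.diff_right matrix_mul_assoc)
  moreover have "trace E = 0"
    unfolding E_def by (rule tr[OF R(1)])
  ultimately have "E = 0"
    by (rule trace_idempotent_eq_0)
  with AE show ?thesis by simp
qed

lemma norm_mscale: "norm (mscale c A) = norm c * norm A"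
proof -
  have "norm (mscale c A $ i) = norm c * norm (A $ i)" for i
    using norm_vec_scale[of c "A $ i"] by (simp add: mscale_def map_matrix_def)
  then show ?thesis
    unfolding norm_vec_def[of "mscale c A"] norm_vec_def[of A] by (simp add: L2_set_right_distrib)
qed

lemma mexp_mscale_mat_1: "mexp (mscale c (mat 1)) = mscale (exp c) (mat 1 :: complex^'n^'n)"
proof -
  have pow: "mpow (mat 1 :: complex^'n^'n) k = mat 1" for k
    by (induction k) auto
  have "(\<lambda>k. mat 1 $ i $ j / fact k * c ^ k) sums (mscale (exp c) (mat 1 :: complex^'n^'n) $ i $ j)" for i j
    using sums_mult[OF exp_converges[of c], of "mat 1 $ i $ j :: complex"]
    by (simp add: scaleR_conv_of_real field_simps)
  moreover have "(\<lambda>k. mat 1 $ i $ j / fact k * c ^ k) sums (mexp (mscale c (mat 1 :: complex^'n^'n)) $ i $ j)" for i j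
    using mexp_scale_entry_sums[of "mat 1 :: complex^'n^'n" i j c] by (simp add: pow mscale_def)
  ultimately have "mexp (mscale c (mat 1)) $ i $ j = mscale (exp c) (mat 1 :: complex^'n^'n) $ i $ j" for i j
    using sums_unique2 by blast
  then show ?thesis
    by (simp add: vec_eq_iff)
qed

text \<open>Conjugation by exp (t A) multiplies \<open>X\<close> by exp (t c). Boundedness for t of
  both signs bounds exp (t Re c) over all real t.\<close>

lemma lie_bracket_eigenvalue_imaginary:
  fixes A :: "real^'n^'n"
  assumes K: "\<And>t. norm (mexp (t *\<^sub>R A)) \<le> K"
    and X: "lie_bracket (complexify A) X = mscale c X" "X \<noteq> 0"
  shows "Re c = 0"
proof -
  define H where "H = complexify A"
  define I :: "complex^'n^'n" where "I = mat 1"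
  \<comment> \<open>In this form the eigenvalue equation shows that X exp (t (H + c)) solves the
    same equation as exp (t H) X, with the same value at t = 0.\<close>
  have HX: "H ** X = X ** (H + mscale c I)"
    using X(1) by (simp add: lie_bracket_def H_def I_def matrix_mult.add_right mscale_matrix_mult_right algebra_simps)
  have KH: "norm (mexp (t *\<^sub>R H)) \<le> K" for t
    using K[of t] by (simp add: H_def flip: complexify_scaleR complexify_mexp)
  have K0: "K \<ge> 0"
    using order_trans[OF norm_ge_zero K] .
  have "t * Re c \<le> K * K" for t
  proof -
    have "((\<lambda>t. X ** mexp (t *\<^sub>R (H + mscale c I))) has_vector_derivative
        H ** (X ** mexp (t *\<^sub>R (H + mscale c I)))) (at t)" for t
      using matrix_mult.has_vector_derivative[OF has_vector_derivative_const
          mexp_has_vector_derivative[of "H + mscale c I" t], of X]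
      by (simp add: HX matrix_mul_assoc)
    from mexp_ODE_unique[of "\<lambda>t. X ** mexp (t *\<^sub>R (H + mscale c I))", OF this, of t]
    have "mexp (t *\<^sub>R H) ** X = X ** mexp (t *\<^sub>R (H + mscale c I))"
      by simp
    also have "t *\<^sub>R (H + mscale c I) = t *\<^sub>R H + mscale (t * c) I"
      by (simp add: scaleR_eq_mscale cmat.scale_right_distrib)
    also have "mexp \<dots> = mexp (t *\<^sub>R H) ** mscale (exp (t * c)) I"
      unfolding I_def mexp_mscale_mat_1[symmetric]
      by (rule mexp_add) (simp add: mscale_matrix_mult_left mscale_matrix_mult_right)
    finally have "mexp (t *\<^sub>R H) ** X = mscale (exp (t * c)) (X ** mexp (t *\<^sub>R H))"
      by (simp add: I_def mscale_matrix_mult_right)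
    then have "mexp (t *\<^sub>R H) ** X ** mexp (- (t *\<^sub>R H)) = mscale (exp (t * c)) X"
      by (simp add: mscale_matrix_mult_left flip: matrix_mul_assoc)
    then have "norm (exp (t * c)) * norm X = norm (mexp (t *\<^sub>R H) ** X ** mexp ((- t) *\<^sub>R H))"
      by (simp add: norm_mscale)
    also have "\<dots> \<le> norm (mexp (t *\<^sub>R H)) * norm X * norm (mexp ((- t) *\<^sub>R H))"
      by (intro order_trans[OF norm_matrix_mult_le] mult_right_mono norm_matrix_mult_le) simp
    also have "\<dots> \<le> K * norm X * K"
      by (intro mult_mono KH) (auto simp: K0)
    finally have "exp (t * Re c) * norm X \<le> (K * K) * norm X"
      by (simp add: norm_exp mult_ac)
    then have "exp (t * Re c) \<le> K * K"
      using X(2) by (simp add: mult_le_cancel_right)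
    then show ?thesis
      using exp_ge_add_one_self[of "t * Re c"] by linarith
  qed
  then show ?thesis
    by (rule linear_bounded_above_imp_eq_0)
qed

section \<open>Roots of a compact real form\<close>

lemma complexify_Re_Im: "Z = complexify (map_matrix Re Z) + mscale \<i> (complexify (map_matrix Im Z))"
  by (simp add: vec_eq_iff complex_eq)

text \<open>With the next lemma, this keeps real and imaginary parts inside any complex subspace
  stable under conjugation.\<close>

lemma complexify_Re: "complexify (map_matrix Re Z) = mscale (1 / 2) (Z + conj_mat Z)"
  by (simp add: vec_eq_iff complex_eq_iff)

lemma complexify_Im: "complexify (map_matrix Im Z) = mscale (- \<i> / 2) (Z - conj_mat Z)"
  by (simp add: vec_eq_iff complex_eq_iff)

text \<open>The commutator with \<open>H\<close> is a derivation of the matrix product, so the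
  weights r and -r of the two factors cancel.\<close>

lemma root_space_mult_commute:
  assumes "lie_bracket H X = mscale r X" "lie_bracket H Y = mscale (- r) Y"
  shows "H ** (X ** Y) = (X ** Y) ** H"
proof -
  have HX: "H ** X = X ** H + mscale r X"
    using assms(1) by (simp add: lie_bracket_def algebra_simps)
  have HY: "H ** Y = Y ** H - mscale r Y"
    using assms(2) by (simp add: lie_bracket_def algebra_simps)
  have "H ** (X ** Y) = X ** (H ** Y) + mscale r (X ** Y)"
    by (simp add: matrix_mul_assoc HX matrix_mult.add_left mscale_matrix_mult_left)
  also have "\<dots> = (X ** Y) ** H"
    by (simp add: HY matrix_mult.diff_right mscale_matrix_mult_right matrix_mul_assoc)
  finally show ?thesis .
qed

section \<open>Conjugation on the Cartan subalgebra and on root spaces\<close>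

locale compact_form_root =
  fixes GC :: "(complex^'n^'n) set" and GR T :: "(real^'n^'n) set"
    and \<rho> :: "complex^'n^'n \<Rightarrow> complex"
  assumes alg: "linear_algebraic_group GC"
    and form: "compact_real_form GR GC"
    and torus: "maximal_torus T GR"
    and root: "is_root GC T \<rho>"
begin

lemma GR_compact_group: "subgroup GR GL" "compact GR"
  using form unfolding compact_real_form_def by blast+

lemma T_facts: "T \<subseteq> GR" "subgroup T GL" "compact T" "A \<in> T \<Longrightarrow> B \<in> T \<Longrightarrow> A ** B = B ** A"
  using torus by (auto simp: maximal_torus_def torus_in_def comm_group_GL_iff)

lemma subspace_lie_algebra_T: "subspace (lie_algebra T)"
  by (rule subspace_lie_algebra_commutative) (use T_facts in auto)

lemma bounded_mexp_lie_algebra_T: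
  assumes "A \<in> lie_algebra T"
  shows "\<exists>K. \<forall>t. norm (mexp (t *\<^sub>R A)) \<le> K"
proof -
  obtain K where "\<forall>B\<in>T. norm B \<le> K"
    using compact_imp_bounded[OF T_facts(3)] unfolding bounded_iff by blast
  then have "norm (mexp (t *\<^sub>R A)) \<le> K" for t
    using assms by (simp add: lie_algebra_def)
  then show ?thesis by blast
qed

lemma complexify_mem_cartan:
  assumes "A \<in> lie_algebra T"
  shows "complexify A \<in> cartan T"
proof -
  have "complexify A = complexify A + mscale \<i> (complexify 0)"
    by simp
  then show ?thesis
    unfolding cartan_def using assms subspace_0[OF subspace_lie_algebra_T] by blast
qed

lemma mscale_ii_complexify_mem_cartan:
  assumes "A \<in> lie_algebra T"
  shows "mscale \<i> (complexify A) \<in> cartan T"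
proof -
  have "mscale \<i> (complexify A) = complexify 0 + mscale \<i> (complexify A)"
    by simp
  then show ?thesis
    unfolding cartan_def using assms subspace_0[OF subspace_lie_algebra_T] by blast
qed

lemma \<rho>_complexify_imaginary:
  assumes A: "A \<in> lie_algebra T"
  shows "Re (\<rho> (complexify A)) = 0"
proof -
  obtain K where K: "\<And>t. norm (mexp (t *\<^sub>R A)) \<le> K"
    using bounded_mexp_lie_algebra_T[OF A] by blast
  \<comment> \<open>Since 0 lies in the root space, being different from {0} yields a nonzero root
    vector.\<close>
  have "0 \<in> root_space GC T \<rho>"
    using cmat.subspace_0[OF subspace_lie_algebra[OF alg]]
    by (auto simp: root_space_def lie_bracket_def)
  then obtain X where "X \<in> root_space GC T \<rho>" "X \<noteq> 0"
    using root by (auto simp: is_root_def)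
  with complexify_mem_cartan[OF A] show ?thesis
    by (intro lie_bracket_eigenvalue_imaginary[OF K, of X]) (auto simp: root_space_def)
qed

lemma \<rho>_Re_Im:
  assumes "A \<in> lie_algebra T" "B \<in> lie_algebra T"
  shows "\<rho> (complexify A + mscale \<i> (complexify B)) = \<rho> (complexify A) + \<i> * \<rho> (complexify B)"
  using root assms complexify_mem_cartan mscale_ii_complexify_mem_cartan by (simp add: is_root_def)

text \<open>\<open>\<rho>\<close> is imaginary on the Lie algebra of \<open>T\<close>. If its values
  at A and B are i a and i b with a, b real, then it is i a - b at A + i B and i a + b at A - i
  B.\<close>

lemma conj_mat_cartan:
  assumes "H \<in> cartan T"
  shows "conj_mat H \<in> cartan T \<and> \<rho> (conj_mat H) = - cnj (\<rho> H)"
proof -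
  obtain A B where H: "H = complexify A + mscale \<i> (complexify B)"
    and AB: "A \<in> lie_algebra T" "B \<in> lie_algebra T"
    using assms by (auto simp: cartan_def)
  note B' = lie_algebra_uminus[OF AB(2)]
  have conj: "conj_mat H = complexify A + mscale \<i> (complexify (- B))"
    by (simp add: H vec_eq_iff)
  have m: "complexify (- B) = mscale (- 1) (complexify B)"
    by (simp add: vec_eq_iff)
  have "\<rho> (complexify (- B)) = - 1 * \<rho> (complexify B)"
    using root complexify_mem_cartan[OF AB(2)] unfolding m is_root_def by blast
  then have "\<rho> (conj_mat H) = - cnj (\<rho> H)"
    unfolding conj \<rho>_Re_Im[OF AB(1) B'] unfolding H \<rho>_Re_Im[OF AB]
    using \<rho>_complexify_imaginary[OF AB(1)] \<rho>_complexify_imaginary[OF AB(2)]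
    by (simp add: complex_eq_iff)
  moreover have "conj_mat H \<in> cartan T"
    unfolding conj cartan_def using AB(1) B' by blast
  ultimately show ?thesis by blast
qed

text \<open>The eigenvalue equation at \<open>conj_mat H\<close> is conjugated. The functional
  \<open>\<sigma>\<close> is general so that both \<open>\<rho>\<close> and its negative can be
  inserted.\<close>

lemma conj_mat_root_space_neg:
  assumes \<sigma>: "\<And>H. H \<in> cartan T \<Longrightarrow> \<sigma> (conj_mat H) = - cnj (\<sigma> H)"
    and X: "X \<in> root_space GC T \<sigma>"
  shows "conj_mat X \<in> root_space GC T (\<lambda>H. - \<sigma> H)"
proof -
  have "lie_bracket H (conj_mat X) = mscale (- \<sigma> H) (conj_mat X)" if H: "H \<in> cartan T" for H
  proof -
    have "lie_bracket (conj_mat H) X = mscale (\<sigma> (conj_mat H)) X"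
      using X conj_mat_cartan[OF H] by (simp add: root_space_def)
    then have "conj_mat (lie_bracket (conj_mat H) X) = conj_mat (mscale (- cnj (\<sigma> H)) X)"
      by (simp add: \<sigma>[OF H])
    then show ?thesis
      by (simp add: conj_mat_lie_bracket conj_mat_mscale conj_mat_uminus)
  qed
  with X conj_mat_lie_algebra[OF form] show ?thesis
    by (simp add: root_space_def)
qed

lemma conj_mat_root_space:
  "X \<in> root_space GC T \<rho> \<Longrightarrow> conj_mat X \<in> root_space GC T (\<lambda>H. - \<rho> H)"
  "X \<in> root_space GC T (\<lambda>H. - \<rho> H) \<Longrightarrow> conj_mat X \<in> root_space GC T \<rho>"
  using conj_mat_root_space_neg[of \<rho> X] conj_mat_root_space_neg[of "\<lambda>H. - \<rho> H" X] conj_mat_cartan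
  by auto

lemma conj_mat_image_root_space:
  "conj_mat ` root_space GC T \<rho> = root_space GC T (\<lambda>H. - \<rho> H)"
  "conj_mat ` root_space GC T (\<lambda>H. - \<rho> H) = root_space GC T \<rho>"
  by (auto intro: conj_mat_root_space intro!: image_eqI[of X conj_mat "conj_mat X" for X])

section \<open>The complex span of the brackets\<close>

lemma root_bracket_induct [consumes 1, case_names bracket zero add scale]:
  assumes "Z \<in> root_bracket GC T \<rho>"
    and "\<And>X Y. X \<in> root_space GC T \<rho> \<Longrightarrow> Y \<in> root_space GC T (\<lambda>H. - \<rho> H) \<Longrightarrow> Q (lie_bracket X Y)"
    and "Q 0" "\<And>Z W. Q Z \<Longrightarrow> Q W \<Longrightarrow> Q (Z + W)" "\<And>c Z. Q Z \<Longrightarrow> Q (mscale c Z)"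
  shows "Q Z"
proof -
  have "cmat.subspace {Z. Q Z}"
    using assms(3-5) by (intro cmat.subspaceI) auto
  then show ?thesis
    using assms(1,2) unfolding root_bracket_def by (elim cmat.span_induct) auto
qed

lemma subspace_root_bracket: "cmat.subspace (root_bracket GC T \<rho>)"
  unfolding root_bracket_def by (rule cmat.subspace_span)

lemma lie_bracket_mem_root_bracket:
  "X \<in> root_space GC T \<rho> \<Longrightarrow> Y \<in> root_space GC T (\<lambda>H. - \<rho> H) \<Longrightarrow> lie_bracket X Y \<in> root_bracket GC T \<rho>"
  unfolding root_bracket_def by (rule cmat.span_base) blast

lemma conj_mat_root_bracket:
  "Z \<in> root_bracket GC T \<rho> \<Longrightarrow> conj_mat Z \<in> root_bracket GC T \<rho>"
proof (induction rule: root_bracket_induct)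
  case (bracket X Y)
  \<comment> \<open>Conjugation exchanges the root spaces of the two factors, so they are swapped
    back at the price of a sign.\<close>
  have "conj_mat (lie_bracket X Y) = - lie_bracket (conj_mat Y) (conj_mat X)"
    by (simp add: conj_mat_lie_bracket) (simp add: lie_bracket_def)
  then show ?case
    using bracket by (auto intro!: cmat.subspace_neg subspace_root_bracket
        lie_bracket_mem_root_bracket conj_mat_root_space)
next
  case zero
  have "conj_mat (0 :: complex^'n^'n) = 0"
    by (simp add: vec_eq_iff)
  then show ?case
    using cmat.subspace_0[OF subspace_root_bracket] by simp
qed (auto simp: conj_mat_add conj_mat_mscale intro: cmat.subspace_add cmat.subspace_scale subspace_root_bracket)

lemma root_bracket_lie_algebra:
  "Z \<in> root_bracket GC T \<rho> \<Longrightarrow> Z \<in> lie_algebra GC"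
proof (induction rule: root_bracket_induct)
  case (bracket X Y)
  then show ?case
    by (auto simp: root_space_def intro: lie_bracket_lie_algebra[OF alg])
qed (auto intro: cmat.subspace_0 cmat.subspace_add cmat.subspace_scale subspace_lie_algebra[OF alg])

lemma root_bracket_commute:
  assumes "Z \<in> root_bracket GC T \<rho>" and H: "H \<in> cartan T"
  shows "H ** Z = Z ** H"
  using assms(1)
proof (induction rule: root_bracket_induct)
  case (bracket X Y)
  then show ?case
    using H root_space_mult_commute[of H X "\<rho> H" Y] root_space_mult_commute[of H Y "- \<rho> H" X]
    by (auto simp: root_space_def lie_bracket_def[of X] matrix_mult.diff_left matrix_mult.diff_right)
qed (auto simp: matrix_mult.add_left matrix_mult.add_right mscale_matrix_mult_left mscale_matrix_mult_right)

text \<open>A real point of the bracket lies in the Lie algebra of \<open>GR\<close> and centralizes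
  that of \<open>T\<close>. The conclusion makes the linearity of \<open>\<rho>\<close>, assumed on
  the Cartan subalgebra only, available on the bracket.\<close>

lemma complexify_root_bracket_lie_algebra_T:
  assumes "complexify A \<in> root_bracket GC T \<rho>"
  shows "A \<in> lie_algebra T"
proof (rule maximal_torus_lie_algebra_self_centralizing[OF GR_compact_group torus])
  show "A \<in> lie_algebra GR"
    using root_bracket_lie_algebra[OF assms] complexify_lie_algebra_iff[OF form] by simp
  fix H assume "H \<in> lie_algebra T"
  then have "complexify H ** complexify A = complexify A ** complexify H"
    by (intro root_bracket_commute assms complexify_mem_cartan)
  then show "A ** H = H ** A"
    by (simp flip: complexify_matrix_mult)
qed

lemma complexify_root_bracket:
  assumes "Z \<in> root_bracket GC T \<rho>"
  shows "complexify (map_matrix Re Z) \<in> root_bracket GC T \<rho>"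
    "complexify (map_matrix Im Z) \<in> root_bracket GC T \<rho>"
  unfolding complexify_Re complexify_Im
  by (intro cmat.subspace_scale cmat.subspace_add cmat.subspace_diff subspace_root_bracket
      assms conj_mat_root_bracket)+

text \<open>An \<open>R\<close> commuting with the root space of \<open>\<rho>\<close> has trace zero against every \<open>[X, Y]\<close>. If
  \<open>\<rho> A = 0\<close> then \<open>A\<close> itself is such an \<open>R\<close>.\<close>

lemma \<rho>_eq_0_root_bracket:
  assumes A: "complexify A \<in> root_bracket GC T \<rho>" and \<rho>A: "\<rho> (complexify A) = 0"
  shows "A = 0"
proof -
  note AT = complexify_root_bracket_lie_algebra_T[OF A]
  obtain K where K: "\<And>t. norm (mexp (t *\<^sub>R A)) \<le> K"
    using bounded_mexp_lie_algebra_T[OF AT] by blast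
  \<comment> \<open>The real matrices centralizing the root space form a unital algebra, as
    \<open>bounded_mexp_trace_eq_0\<close> requires.\<close>
  define C where "C = {R. \<forall>X\<in>root_space GC T \<rho>. complexify R ** X = X ** complexify R}"
  have trace0: "trace (Z ** complexify R) = 0" if Z: "Z \<in> root_bracket GC T \<rho>" and R: "R \<in> C" for Z R
    using Z
  proof (induction rule: root_bracket_induct)
    case (bracket X Y)
    \<comment> \<open>By cyclicity tr (X Y R) = tr (Y R X), and \<open>R\<close> commutes with
      \<open>X\<close>, so the two terms of the commutator have the same trace against
      \<open>R\<close>.\<close>
    have "trace (X ** Y ** complexify R) = trace (Y ** complexify R ** X)"
      using trace_mul_sym[of X "Y ** complexify R"] by (simp add: matrix_mul_assoc)
    also have "\<dots> = trace (Y ** X ** complexify R)"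
      using R bracket(1) by (simp add: C_def flip: matrix_mul_assoc)
    finally show ?case
      by (simp add: lie_bracket_def matrix_mult.diff_left trace_sub)
  next
    case (scale c Z)
    then show ?case
      by (simp add: mscale_matrix_mult_left trace_def flip: sum_distrib_left)
  qed (simp_all add: matrix_mult.add_left trace_add trace_0[unfolded mat_0])
  show ?thesis
  proof (rule bounded_mexp_trace_eq_0[OF K])
    show "subspace C"
      by (rule subspaceI) (auto simp: C_def complexify_add complexify_scaleR matrix_mult.add_left
          matrix_mult.add_right matrix_mult_scaleR_left matrix_mult_scaleR_right)
    have "complexify (mat 1) = (mat 1 :: complex^'n^'n)"
      by (simp add: vec_eq_iff mat_def)
    then show "mat 1 \<in> C"
      by (simp add: C_def)
    show "A \<in> C"
      using complexify_mem_cartan[OF AT] \<rho>A by (auto simp: C_def root_space_def lie_bracket_def)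
    show "R ** S \<in> C" if "R \<in> C" "S \<in> C" for R S
      using that by (simp add: C_def complexify_matrix_mult) (metis matrix_mul_assoc)
    show "trace (A ** R) = 0" if "R \<in> C" for R
    proof -
      have "of_real (trace (A ** R)) = trace (complexify A ** complexify R)"
        by (simp add: trace_def flip: complexify_matrix_mult)
      also have "\<dots> = 0"
        by (rule trace0[OF A that])
      finally show ?thesis by simp
    qed
  qed
qed

text \<open>\<open>\<rho>\<close> is imaginary at real points of the bracket, hence real at i times
  them.\<close>

lemma mscale_ii_complexify_mem_real_root_bracket:
  assumes "complexify A \<in> root_bracket GC T \<rho>"
  shows "mscale \<i> (complexify A) \<in> real_root_bracket GC T \<rho>"
proof -
  note AT = complexify_root_bracket_lie_algebra_T[OF assms]
  have "\<rho> (mscale \<i> (complexify A)) = \<i> * \<rho> (complexify A)"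
    using root complexify_mem_cartan[OF AT] by (simp add: is_root_def)
  then have "\<rho> (mscale \<i> (complexify A)) \<in> \<real>"
    using \<rho>_complexify_imaginary[OF AT] by (simp add: complex_is_Real_iff)
  then show ?thesis
    using assms by (simp add: real_root_bracket_def cmat.subspace_scale subspace_root_bracket)
qed

lemma root_bracket_eq_span: "root_bracket GC T \<rho> = cmat.span (real_root_bracket GC T \<rho>)"
proof
  show "cmat.span (real_root_bracket GC T \<rho>) \<subseteq> root_bracket GC T \<rho>"
    by (rule cmat.span_minimal) (auto simp: real_root_bracket_def subspace_root_bracket)
  show "root_bracket GC T \<rho> \<subseteq> cmat.span (real_root_bracket GC T \<rho>)"
  proof
    fix Z assume Z: "Z \<in> root_bracket GC T \<rho>"
    let ?A = "complexify (map_matrix Re Z)" and ?B = "complexify (map_matrix Im Z)"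
    \<comment> \<open>The scalars are arranged so that only i times real points occur, which lie in
      \<open>real_root_bracket\<close>.\<close>
    have "Z = mscale (- \<i>) (mscale \<i> ?A) + mscale \<i> ?B"
      using complexify_Re_Im[of Z] by simp
    moreover have "mscale (- \<i>) (mscale \<i> ?A) + mscale \<i> ?B \<in> cmat.span (real_root_bracket GC T \<rho>)"
      by (intro cmat.span_add cmat.span_scale cmat.span_base mscale_ii_complexify_mem_real_root_bracket
          complexify_root_bracket Z)
    ultimately show "Z \<in> cmat.span (real_root_bracket GC T \<rho>)"
      by simp
  qed
qed

text \<open>For Z = A + i B the values \<rho>(A) and i \<rho>(B) are imaginary and real
  respectively. A real sum forces \<rho>(A) = 0, hence A = 0, and conjugation negates i B.\<close>

lemma conj_mat_real_root_bracket:
  assumes "Z \<in> real_root_bracket GC T \<rho>"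
  shows "conj_mat Z = - Z"
proof -
  have Z: "Z \<in> root_bracket GC T \<rho>" "\<rho> Z \<in> \<real>"
    using assms by (auto simp: real_root_bracket_def)
  let ?A = "map_matrix Re Z" and ?B = "map_matrix Im Z"
  note AB = complexify_root_bracket[OF Z(1)]
  note T = AB[THEN complexify_root_bracket_lie_algebra_T]
  have "\<rho> Z = \<rho> (complexify ?A) + \<i> * \<rho> (complexify ?B)"
    by (subst complexify_Re_Im[of Z]) (rule \<rho>_Re_Im[OF T])
  then have "\<rho> (complexify ?A) = 0"
    using Z(2) T[THEN \<rho>_complexify_imaginary] by (simp add: complex_eq_iff complex_is_Real_iff)
  then have "?A = 0"
    by (rule \<rho>_eq_0_root_bracket[OF AB(1)])
  then show ?thesis
    by (simp add: vec_eq_iff complex_eq_iff)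
qed

end

text \<open>Conjugation being conjugate linear, minus the identity is asserted on the part of the
  bracket where \<open>\<rho>\<close> is real. That part spans the bracket over the complex numbers
  by the third conjunct, so the assertion determines conjugation on all of it.\<close>

theorem lemma2:
  fixes GC :: "(complex^'n^'n) set" and GR T :: "(real^'n^'n) set"
    and \<rho> :: "complex^'n^'n \<Rightarrow> complex"
  assumes "simple_algebraic_group GC"
    and "compact_real_form GR GC"
    and "maximal_torus T GR"
    and "is_root GC T \<rho>"
  shows "conj_mat ` root_space GC T \<rho> = root_space GC T (\<lambda>H. - \<rho> H) \<and>
         conj_mat ` root_space GC T (\<lambda>H. - \<rho> H) = root_space GC T \<rho> \<and>
         root_bracket GC T \<rho> = cmat.span (real_root_bracket GC T \<rho>) \<and>
         (\<forall>Z \<in> real_root_bracket GC T \<rho>. conj_mat Z = - Z)"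
proof -
  interpret compact_form_root GC GR T \<rho>
    using assms by unfold_locales (auto simp: simple_algebraic_group_def)
  show ?thesis
    using conj_mat_image_root_space root_bracket_eq_span conj_mat_real_root_bracket by blast
qed

end
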